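(* Let $n\ge 4$ and $k\ge 3$. Set $$f(n,k)=\begin{cases}\binom{n+k}{n}-\binom{n+k-2}{n}-\binom{n+\frac{k}{2}}{n}+\binom{n-2+\frac{k}{2}}{n} & \text{if } k \text{ is even},\\[4pt] \binom{n+k}{n}-\binom{n+k-2}{n}-2\binom{n+\frac{k-1}{2}}{n}+2\binom{n+\frac{k-3}{2}}{n} & \text{if } k \text{ is odd}.\end{cases}$$ Choose any integer $N\ge f(n,k)$. Then there exist linear forms $L_1,\ldots,L_N\in R=\mathbb{K}[x_0,\ldots,x_n]$ satisfying: - no $n+1$ of the linear forms have a common zero (in $\mathbb{P}^n$), and - $R/(L_1^k,\ldots,L_N^k)$ fails the Weak Lefschetz Property from degree $k-1$ to degree $k$.
   Context: $\mathbb{K}$ is an algebraically closed field of characteristic $0$. For an artinian graded algebra $R/I$ and a general linear form $L$, $R/I$ fails the Weak Lefschetz Property (WLP) from degree $i$ to degree $i+1$ if the multiplication map $\times L:[R/I]_i\to[R/I]_{i+1}$ does not have maximal rank (is neither injective nor surjective). *)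

theory Defs
  imports
    "HOL-Computational_Algebra.Polynomial"
    "HOL-Library.Poly_Mapping"
    "HOL-Algebra.QuotRing"
begin

section \<open>The polynomial ring in the variables 0, \<dots>, n\<close>

text \<open>A monomial is a finitely supported exponent vector \<open>nat \<Rightarrow>\<^sub>0 nat\<close>, and a polynomial is a
  finitely supported family of coefficients indexed by monomials, with the convolution product of
  \<open>Poly_Mapping\<close>. The ring \<open>K[x_0,\<dots>,x_n]\<close> consists of those polynomials in which only variables
  of index at most \<open>n\<close> occur (so there are \<open>n + 1\<close> variables).\<close>

type_synonym monomial = "nat \<Rightarrow>\<^sub>0 nat"
type_synonym 'k mpoly = "monomial \<Rightarrow>\<^sub>0 'k"

definition mpoly_ring :: "nat \<Rightarrow> ('k::comm_ring_1) mpoly ring" where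
  "mpoly_ring n =
     \<lparr>carrier = {p. \<forall>m\<in>Poly_Mapping.keys p. Poly_Mapping.keys m \<subseteq> {..n}},
      mult = (*), one = 1, zero = 0, add = (+)\<rparr>"

definition mdeg :: "monomial \<Rightarrow> nat" where
  "mdeg m = (\<Sum>i\<in>Poly_Mapping.keys m. Poly_Mapping.lookup m i)"

text \<open>The component \<open>[R]_d\<close>; it contains the zero polynomial.\<close>

definition forms :: "nat \<Rightarrow> nat \<Rightarrow> ('k::comm_ring_1) mpoly set" where
  "forms n d = {p \<in> carrier (mpoly_ring n). \<forall>m\<in>Poly_Mapping.keys p. mdeg m = d}"

definition eval_mpoly :: "(nat \<Rightarrow> 'k) \<Rightarrow> ('k::comm_ring_1) mpoly \<Rightarrow> 'k" where
  "eval_mpoly a p =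
     (\<Sum>m\<in>Poly_Mapping.keys p. Poly_Mapping.lookup p m *
        (\<Prod>i\<in>Poly_Mapping.keys m. a i ^ Poly_Mapping.lookup m i))"

text \<open>A point of \<open>P^n\<close> is given by homogeneous coordinates \<open>a 0, \<dots>, a n\<close>, not all zero.\<close>

definition common_zero_proj :: "nat \<Rightarrow> ('k::comm_ring_1) mpoly set \<Rightarrow> bool" where
  "common_zero_proj n S \<longleftrightarrow>
     (\<exists>a. (\<exists>i\<le>n. a i \<noteq> 0) \<and> (\<forall>p\<in>S. eval_mpoly a p = 0))"

lemma cring_mpoly_ring: "cring (mpoly_ring n :: ('k::comm_ring_1) mpoly ring)"
proof (rule cringI)
  show "abelian_group (mpoly_ring n :: 'k mpoly ring)"
  proof (rule abelian_groupI)
    fix x y :: "'k mpoly"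
    assume "x \<in> carrier (mpoly_ring n)" "y \<in> carrier (mpoly_ring n)"
    then show "x \<oplus>\<^bsub>mpoly_ring n\<^esub> y \<in> carrier (mpoly_ring n)"
      using Poly_Mapping.keys_add[of x y] by (auto simp: mpoly_ring_def)
  next
    fix x :: "'k mpoly"
    assume "x \<in> carrier (mpoly_ring n)"
    then show "\<exists>y\<in>carrier (mpoly_ring n). y \<oplus>\<^bsub>mpoly_ring n\<^esub> x = \<zero>\<^bsub>mpoly_ring n\<^esub>"
      by (intro bexI[of _ "- x"]) (auto simp: mpoly_ring_def keys_minus)
  qed (auto simp: mpoly_ring_def algebra_simps)
  show "comm_monoid (mpoly_ring n :: 'k mpoly ring)"
  proof (rule comm_monoidI)
    fix x y :: "'k mpoly"
    assume *: "x \<in> carrier (mpoly_ring n)" "y \<in> carrier (mpoly_ring n)"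
    have "Poly_Mapping.keys m \<subseteq> {..n}" if m: "m \<in> Poly_Mapping.keys (x * y)" for m
    proof -
      obtain a b where ab: "a \<in> Poly_Mapping.keys x" "b \<in> Poly_Mapping.keys y" "m = a + b"
        using m Poly_Mapping.keys_mult[of x y] by blast
      then show ?thesis
        using * Poly_Mapping.keys_add[of a b] by (fastforce simp: mpoly_ring_def)
    qed
    then show "x \<otimes>\<^bsub>mpoly_ring n\<^esub> y \<in> carrier (mpoly_ring n)"
      by (auto simp: mpoly_ring_def)
  qed (auto simp: mpoly_ring_def algebra_simps)
qed (auto simp: mpoly_ring_def algebra_simps)

section \<open>General linear forms\<close>

text \<open>The space \<open>[R]_1\<close> of linear forms is identified with affine \<open>(n+1)\<close>-space via the
  coefficients; a Zariski open subset is the complement of the common zero locus of a set of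
  polynomials in these coefficients.\<close>

definition lin_coeff :: "('k::comm_ring_1) mpoly \<Rightarrow> nat \<Rightarrow> 'k" where
  "lin_coeff L i = Poly_Mapping.lookup L (Poly_Mapping.single i 1)"

definition zariski_open_linear :: "nat \<Rightarrow> ('k::comm_ring_1) mpoly set \<Rightarrow> bool" where
  "zariski_open_linear n U \<longleftrightarrow>
     (\<exists>S \<subseteq> carrier (mpoly_ring n).
        U = {L \<in> forms n 1. \<exists>P\<in>S. eval_mpoly (lin_coeff L) P \<noteq> 0})"

definition holds_for_general_linear_form ::
    "nat \<Rightarrow> (('k::comm_ring_1) mpoly \<Rightarrow> bool) \<Rightarrow> bool" where
  "holds_for_general_linear_form n Q \<longleftrightarrow>
     (\<exists>U. zariski_open_linear n U \<and> U \<noteq> {} \<and> (\<forall>L\<in>U. Q L))"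

section \<open>Failure of the weak Lefschetz property\<close>

text \<open>Descending chain condition on ideals; used only for commutative rings.\<close>

definition artinian_ring :: "('a, 'b) ring_scheme \<Rightarrow> bool" where
  "artinian_ring A \<longleftrightarrow> ring A \<and>
     (\<forall>J :: nat \<Rightarrow> 'a set. (\<forall>m. ideal (J m) A) \<and> (\<forall>m. J (Suc m) \<subseteq> J m)
        \<longrightarrow> (\<exists>m. \<forall>m'\<ge>m. J m' = J m))"

text \<open>For a homogeneous ideal \<open>I\<close>, the component \<open>[R/I]_d\<close> is the set of residue classes of forms
  of degree \<open>d\<close>.\<close>

definition quot_component :: "nat \<Rightarrow> ('k::comm_ring_1) mpoly set \<Rightarrow> nat \<Rightarrow> 'k mpoly set set" where
  "quot_component n I d = (\<lambda>p. I +>\<^bsub>mpoly_ring n\<^esub> p) ` forms n d"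

definition mult_by ::
    "nat \<Rightarrow> ('k::comm_ring_1) mpoly set \<Rightarrow> 'k mpoly \<Rightarrow> 'k mpoly set \<Rightarrow> 'k mpoly set" where
  "mult_by n I L X = (I +>\<^bsub>mpoly_ring n\<^esub> L) \<otimes>\<^bsub>mpoly_ring n Quot I\<^esub> X"

text \<open>The property is only considered for artinian quotients, so being artinian is part of the
  definition of failure.\<close>

definition fails_WLP_from :: "nat \<Rightarrow> ('k::comm_ring_1) mpoly set \<Rightarrow> nat \<Rightarrow> bool" where
  "fails_WLP_from n I i \<longleftrightarrow>
     artinian_ring (mpoly_ring n Quot I) \<and>
     holds_for_general_linear_form n (\<lambda>L.
       \<not> inj_on (mult_by n I L) (quot_component n I i) \<and>
       mult_by n I L ` quot_component n I i \<noteq> quot_component n I (i + 1))"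

section \<open>The numerical bound\<close>

text \<open>Integer-valued, to avoid truncated subtraction. The divisions by 2 are exact, and for
  \<open>n \<ge> 2\<close> and \<open>k \<ge> 3\<close> the subtractions inside the binomial coefficients are not truncated.\<close>

definition f_bound :: "nat \<Rightarrow> nat \<Rightarrow> int" where
  "f_bound n k =
     (if even k then
        int ((n + k) choose n) - int ((n + k - 2) choose n)
          - int ((n + k div 2) choose n) + int ((n - 2 + k div 2) choose n)
      else
        int ((n + k) choose n) - int ((n + k - 2) choose n)
          - 2 * int ((n + (k - 1) div 2) choose n) + 2 * int ((n + (k - 3) div 2) choose n))"

end

theory Submission
  imports Defs
begin

text \<open>A linear form is identified with its coefficient vector, a point of the dual space. The forms are
  chosen on the cone \<open>X\<close> over the cubic scroll \<open>S(1,2)\<close>, a variety of codimension 2 and degree 3, on a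
  curve so generic that any \<open>n + 1\<close> of the points are independent and that a form of degree \<open>k\<close>
  vanishing at \<open>N\<close> of them vanishes on \<open>X\<close>. The latter only needs \<open>N\<close> to be at least the value at \<open>k\<close> of
  the Hilbert function of \<open>X\<close>, which is at most the bound \<open>f\<close>; by duality the \<open>k\<close>-th powers of all
  points of \<open>X\<close> then lie in the ideal. A general \<open>L\<close> is a difference \<open>p - q\<close> of two points of \<open>X\<close>, so \<open>L\<close>
  divides \<open>p^k - q^k\<close>, which refutes injectivity. The projection of \<open>X\<close> from \<open>L\<close> is a cubic
  hypersurface, so a cone of degree \<open>k\<close> with vertex \<open>L\<close> contains \<open>X\<close>; it is a functional that kills the
  ideal and all multiples of \<open>L\<close> in degree \<open>k\<close>, which refutes surjectivity.\<close>

section \<open>Points in general position for sparse polynomials\<close>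

lemma finite_coeff_support: "finite {i. coeff p i \<noteq> 0}"
  by (rule finite_subset[of _ "{..degree p}"]) (auto simp: le_degree)

text \<open>Equivalently, every square generalized Vandermonde matrix with nodes in \<open>T\<close>
  and distinct exponents at most \<open>D\<close> is nonsingular. The nodes are added one at a time,
  each avoiding the roots of finitely many polynomials.\<close>

lemma sparse_general_points:
  fixes D N :: nat
  shows "\<exists>T :: 'k::field_char_0 set. finite T \<and> card T = N \<and>
    (\<forall>p. p \<noteq> 0 \<longrightarrow> degree p \<le> D \<longrightarrow> card {t \<in> T. poly p t = 0} < card {i. coeff p i \<noteq> 0})"
proof (induction N)
  case 0
  have "0 < card {i. coeff p i \<noteq> 0}" if "p \<noteq> 0" for p :: "'k poly"
    using that finite_coeff_support[of p] by (auto simp: card_gt_0_iff poly_eq_iff)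
  then show ?case by (intro exI[of _ "{}"]) auto
next
  case (Suc N)
  then obtain T :: "'k set" where T: "finite T" "card T = N"
    and good: "\<And>p. p \<noteq> 0 \<Longrightarrow> degree p \<le> D \<Longrightarrow> card {t \<in> T. poly p t = 0} < card {i. coeff p i \<noteq> 0}"
    by blast
  define supp where "supp p = {i. coeff p i \<noteq> 0}" for p :: "'k poly"
  define rts where "rts p = {t \<in> T. poly p t = 0}" for p :: "'k poly"
  have fs: "finite (supp p)" for p unfolding supp_def by (rule finite_coeff_support)
  have fr: "finite (rts p)" for p unfolding rts_def using T by auto
  \<comment> \<open>A new point is bad only if it is a root of a polynomial with one zero less in \<open>T\<close> than it has
    terms; up to scaling such a polynomial is determined by its support and its zeros in \<open>T\<close>.\<close>
  define crit where "crit = {p. lead_coeff p = 1 \<and> degree p \<le> D \<and> card (supp p) \<le> Suc (card (rts p))}"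
  have inj: "inj_on (\<lambda>p. (supp p, rts p)) crit"
  proof (rule inj_onI, rule ccontr)
    fix p q assume p: "p \<in> crit" and q: "q \<in> crit" and eq: "(supp p, rts p) = (supp q, rts q)" and "p \<noteq> q"
    have deg: "degree p = Max (supp p)" if "p \<in> crit" for p
      using that fs[of p] by (intro Max_eqI[symmetric]) (auto simp: supp_def crit_def le_degree)
    have dpq: "degree p = degree q" using deg[OF p] deg[OF q] eq by simp
    \<comment> \<open>Both polynomials are monic with the same support, so the leading terms cancel:
      \<open>r\<close> has fewer terms than \<open>p\<close>, hence no more terms than the zeros it
      keeps in \<open>T\<close>, against the induction hypothesis.\<close>
    define r where "r = p - q"
    have r0: "r \<noteq> 0" using \<open>p \<noteq> q\<close> by (simp add: r_def)
    have rD: "degree r \<le> D" using p q unfolding r_def crit_def by (auto intro: order.trans[OF degree_diff_le])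
    have "supp r \<subseteq> supp p - {degree p}"
      using p q eq dpq unfolding r_def crit_def supp_def by force
    moreover have "degree p \<in> supp p" using p by (auto simp: supp_def crit_def)
    ultimately have "card (supp r) \<le> card (supp p) - 1"
      using card_mono[of "supp p - {degree p}" "supp r"] fs[of p] by simp
    also have "\<dots> \<le> card (rts p)" using p by (auto simp: crit_def)
    also have "\<dots> \<le> card (rts r)"
      using eq fr[of r] by (intro card_mono) (auto simp: rts_def r_def)
    finally show False using good[OF r0 rD] by (simp add: supp_def rts_def)
  qed
  have "(\<lambda>p. (supp p, rts p)) ` crit \<subseteq> Pow {..D} \<times> Pow T"
    by (fastforce simp: supp_def rts_def crit_def dest: le_degree)
  then have "finite crit"
    using inj T(1) by (meson finite_Pow_iff finite_SigmaI finite_atMost finite_imageD finite_subset)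
  moreover have "p \<noteq> 0" if "p \<in> crit" for p using that by (auto simp: crit_def)
  ultimately have "finite (T \<union> (\<Union>p\<in>crit. {x. poly p x = 0}))"
    using T(1) by (auto intro!: poly_roots_finite)
  then obtain t where t: "t \<notin> T" "\<And>p. p \<in> crit \<Longrightarrow> poly p t \<noteq> 0"
    using ex_new_if_finite[OF infinite_UNIV_char_0] by blast
  have "card {x \<in> insert t T. poly p x = 0} < card {i. coeff p i \<noteq> 0}" if p: "p \<noteq> 0" "degree p \<le> D" for p
  proof (cases "poly p t = 0")
    case False
    then have "{x \<in> insert t T. poly p x = 0} = {x \<in> T. poly p x = 0}" by auto
    then show ?thesis using good[OF p] by simp
  next
    case True
    define q where "q = smult (inverse (lead_coeff p)) p"
    have q: "lead_coeff q = 1" "degree q \<le> D" "supp q = supp p" "rts q = rts p" "poly q t = 0"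
      using p True by (auto simp: q_def supp_def rts_def)
    have "q \<notin> crit" using t(2) q(5) by blast
    then have "Suc (card (rts p)) < card (supp p)" using q by (auto simp: crit_def)
    moreover have "{x \<in> insert t T. poly p x = 0} = insert t (rts p)" using True by (auto simp: rts_def)
    ultimately show ?thesis using t(1) fr[of p] by (simp add: rts_def supp_def)
  qed
  then show ?case using T t(1) by (intro exI[of _ "insert t T"]) auto
qed

section \<open>Exponents on the scroll\<close>

text \<open>Expanding over words rather than multi-indices keeps multinomial coefficients out: equal
  monomials simply occur several times.\<close>

lemma power_sum_words:
  fixes f :: "'a \<Rightarrow> 'b::comm_semiring_1"
  assumes "finite A"
  shows "(\<Sum>i\<in>A. f i) ^ k = (\<Sum>w | set w \<subseteq> A \<and> length w = k. prod_list (map f w))"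
proof (induction k)
  case 0
  have "{w. set w \<subseteq> A \<and> length w = 0} = {[]}" by auto
  then show ?case by simp
next
  case (Suc k)
  let ?W = "\<lambda>k. {w. set w \<subseteq> A \<and> length w = k}"
  have eq: "?W (Suc k) = (\<lambda>(x, w). x # w) ` (A \<times> ?W k)"
    by (auto simp: length_Suc_conv image_iff)
  have "(\<Sum>w\<in>?W (Suc k). prod_list (map f w)) = (\<Sum>(x, w)\<in>A \<times> ?W k. f x * prod_list (map f w))"
    unfolding eq by (subst sum.reindex) (auto simp: inj_on_def case_prod_unfold)
  also have "\<dots> = (\<Sum>x\<in>A. f x) * (\<Sum>w\<in>?W k. prod_list (map f w))"
    by (simp add: sum_product sum.cartesian_product)
  finally show ?case using Suc by simp
qed

lemma finite_words: "finite A \<Longrightarrow> finite {w. set w \<subseteq> A \<and> length w = k}"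
  by (rule finite_lists_length_eq)

lemma digits_unique:
  fixes a b :: "nat \<Rightarrow> nat"
  assumes "\<And>j. j < m \<Longrightarrow> a j < B" "\<And>j. j < m \<Longrightarrow> b j < B"
    and "(\<Sum>j<m. a j * B ^ j) = (\<Sum>j<m. b j * B ^ j)" and "j < m"
  shows "a j = b j"
  using assms
proof (induction m arbitrary: a b j)
  case (Suc m)
  have shift: "(\<Sum>j<Suc m. c j * B ^ j) = c 0 + B * (\<Sum>j<m. c (Suc j) * B ^ j)" for c :: "nat \<Rightarrow> nat"
    by (simp only: sum.lessThan_Suc_shift) (simp add: sum_distrib_left algebra_simps)
  have eq: "a 0 + B * (\<Sum>j<m. a (Suc j) * B ^ j) = b 0 + B * (\<Sum>j<m. b (Suc j) * B ^ j)"
    using Suc.prems(3) unfolding shift .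
  have lt: "a 0 < B" "b 0 < B" using Suc.prems(1,2)[of 0] by auto
  have "a 0 = b 0" using arg_cong[OF eq, of "\<lambda>x. x mod B"] lt by simp
  moreover from this have "(\<Sum>j<m. a (Suc j) * B ^ j) = (\<Sum>j<m. b (Suc j) * B ^ j)" using eq lt by auto
  ultimately show ?case
    using Suc.IH[of "a \<circ> Suc" "b \<circ> Suc" "j - 1"] Suc.prems by (cases j) auto
qed simp

text \<open>The scroll is parametrized by \<open>z i = u ^ tau i * y (grp i)\<close>: the coordinates 0, 1 are
  \<open>y 1 * (1, u)\<close>, the coordinates 2, 3, 4 are \<open>y 2 * (1, u, u^2)\<close>, and the others are free.
  Substituting \<open>u = t\<close> and \<open>y g = t ^ (B ^ g)\<close> gives a curve on it, and for large \<open>B\<close> the base-\<open>B\<close>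
  digits of the exponent of \<open>t\<close> recover those of \<open>u\<close> and of all \<open>y g\<close>.\<close>

definition tau :: "nat \<Rightarrow> nat" where
  "tau i = (if i = 1 \<or> i = 3 then 1 else if i = 4 then 2 else 0)"

definition grp :: "nat \<Rightarrow> nat" where
  "grp i = (if i \<le> 1 then 1 else if i \<le> 4 then 2 else i - 2)"

definition scroll_exp :: "nat \<Rightarrow> nat \<Rightarrow> nat" where
  "scroll_exp B i = tau i + B ^ grp i"

definition word_exp :: "nat \<Rightarrow> nat list \<Rightarrow> nat" where
  "word_exp B w = sum_list (map (scroll_exp B) w)"

lemma grp_bounds: "n \<ge> 4 \<Longrightarrow> i \<le> n \<Longrightarrow> 0 < grp i \<and> grp i < n - 1"
  by (auto simp: grp_def)

text \<open>Groups are numbered from 1, which leaves digit 0 free for the exponent of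
  \<open>u\<close>; a digit \<open>j > 0\<close> is the exponent of \<open>y j\<close>.\<close>

definition word_digit :: "nat list \<Rightarrow> nat \<Rightarrow> nat" where
  "word_digit w j = (if j = 0 then sum_list (map tau w) else count (mset (map grp w)) j)"

lemma word_exp_digits:
  assumes "n \<ge> 4" "set w \<subseteq> {..n}"
  shows "word_exp B w = (\<Sum>j<n - 1. word_digit w j * B ^ j)"
  using assms(2)
proof (induction w)
  case Nil
  then show ?case by (simp add: word_exp_def word_digit_def)
next
  case (Cons x w)
  have g: "0 < grp x" "grp x < n - 1" using grp_bounds[OF assms(1)] Cons.prems by auto
  have "word_digit (x # w) j * B ^ j = word_digit w j * B ^ j + (if j = 0 then tau x * B ^ j else 0)
      + (if j = grp x then B ^ j else 0)" for j
    using g by (auto simp: word_digit_def algebra_simps)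
  then have "(\<Sum>j<n - 1. word_digit (x # w) j * B ^ j) =
     (\<Sum>j<n - 1. word_digit w j * B ^ j) + (\<Sum>j<n - 1. if j = 0 then tau x * B ^ j else 0)
       + (\<Sum>j<n - 1. if j = grp x then B ^ j else 0)"
    by (simp only: sum.distrib)
  also have "\<dots> = word_exp B w + tau x + B ^ grp x" using Cons g assms(1) by simp
  finally show ?case by (simp add: word_exp_def scroll_exp_def)
qed

lemma sum_tau_le: "sum_list (map tau w) \<le> 2 * length w"
  by (induction w) (auto simp: tau_def)

text \<open>Each digit is at most twice the length of the word, because \<open>tau\<close> is at
  most 2, so no carry occurs below \<open>B\<close>. Equal exponents of \<open>t\<close> therefore
  mean equal monomials in \<open>u\<close> and the \<open>y g\<close>: the curve distinguishes as
  much as the whole scroll.\<close>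

lemma word_exp_decode:
  assumes "n \<ge> 4" "set w \<subseteq> {..n}" "set w' \<subseteq> {..n}" "2 * length w < B" "2 * length w' < B"
    and "word_exp B w = word_exp B w'"
  shows "sum_list (map tau w) = sum_list (map tau w')" "mset (map grp w) = mset (map grp w')"
proof -
  have lt: "word_digit w j < B" if "2 * length w < B" for w j
    using sum_tau_le[of w] count_le_size[of "mset (map grp w)" j] that
    by (auto simp: word_digit_def simp del: mset_map)
  have eq: "word_digit w j = word_digit w' j" if "j < n - 1" for j
    using digits_unique[of "n - 1" "word_digit w" B "word_digit w'" j] lt assms that
    by (simp add: word_exp_digits)
  show "sum_list (map tau w) = sum_list (map tau w')"
    using eq[of 0] assms(1) by (simp add: word_digit_def)
  show "mset (map grp w) = mset (map grp w')"
  proof (rule multiset_eqI)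
    fix j
    have out: "count (mset (map grp w)) j = 0" if "j = 0 \<or> j \<ge> n - 1" "set w \<subseteq> {..n}" for w
    proof -
      have "j \<noteq> grp i" if "i \<in> set w" for i
        using grp_bounds[OF assms(1), of i] that \<open>j = 0 \<or> j \<ge> n - 1\<close> \<open>set w \<subseteq> {..n}\<close> by auto
      then have "j \<notin># mset (map grp w)" by auto
      then show ?thesis by (simp only: not_in_iff)
    qed
    show "count (mset (map grp w)) j = count (mset (map grp w')) j"
    proof (cases "j = 0 \<or> j \<ge> n - 1")
      case True
      then show ?thesis using out assms(2,3) by metis
    next
      case False
      then show ?thesis using eq[of j] by (simp add: word_digit_def)
    qed
  qed
qed

lemma scroll_exp_inj:
  assumes "n \<ge> 4" "B > 2" shows "inj_on (scroll_exp B) {..n}"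
proof (rule inj_onI)
  fix i i' assume "i \<in> {..n}" "i' \<in> {..n}" "scroll_exp B i = scroll_exp B i'"
  then have "tau i = tau i'" "grp i = grp i'"
    using word_exp_decode[of n "[i]" "[i']" B] assms by (auto simp: word_exp_def)
  moreover have "x = (if grp x = 1 then tau x else if grp x = 2 then tau x + 2 else grp x + 2)" for x
    by (simp add: tau_def grp_def) linarith
  ultimately show "i = i'" by metis
qed

text \<open>The right-hand side is the coefficient of \<open>x ^ k\<close> in
  \<open>(1 + 2 * x) / (1 - x) ^ (n - 1)\<close>, the Hilbert series of the cone over the scroll.
  Only an upper bound is claimed, so collisions of exponents do no harm and \<open>B\<close> is
  arbitrary.\<close>

lemma card_word_exps_le:
  assumes n: "n \<ge> 4" and k: "k \<ge> 1"
  shows "card (word_exp B ` {w. set w \<subseteq> {..n} \<and> length w = k}) \<le>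
    ((n + k - 2) choose (n - 2)) + 2 * ((n + k - 3) choose (n - 2))"
proof -
  \<comment> \<open>\<open>L s\<close> holds the exponent vectors of degree \<open>s\<close> in
    \<open>n - 1\<close> variables. \<open>val\<close> assembles an exponent from the degree
    \<open>t\<close> in \<open>u\<close>, the degrees \<open>a\<close> and \<open>b\<close> of
    groups 1 and 2, and the degrees \<open>r\<close> of the free groups, which start at digit
    3.\<close>
  define L where "L s = {l :: nat list. length l = n - 1 \<and> sum_list l = s}" for s
  define R where "R r = (\<Sum>j<length r. r ! j * B ^ (j + 3))" for r
  define val where "val t a b r = t + a * B + b * B ^ 2 + R r" for t a b r
  \<comment> \<open>Apart from the free coordinates, \<open>f1\<close> encodes monomials in the
    coordinates 0, 2, 4; \<open>f2\<close> encodes these times one factor of coordinate 3;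
    \<open>f3\<close> encodes monomials in 0, 1, 4 with at least one factor of coordinate 1.\<close>
  define f1 where "f1 l = (case l of x # y # z # r \<Rightarrow> val (2 * y) x (y + z) r | _ \<Rightarrow> 0)" for l
  define f2 where "f2 l = (case l of x # y # z # r \<Rightarrow> val (2 * y + 1) x (y + z + 1) r | _ \<Rightarrow> 0)" for l
  define f3 where "f3 l = (case l of x # y # z # r \<Rightarrow> val (2 * z + x + 1) (x + 1 + y) z r | _ \<Rightarrow> 0)" for l
  have finL: "finite (L s)" for s
    by (rule finite_subset[OF _ finite_lists_length_eq[of "{..s}" "n - 1"]])
      (auto simp: L_def member_le_sum_list)
  have cardL: "card (L s) = (s + n - 2) choose s" for s
    unfolding L_def card_length_sum_list using n by (simp add: numeral_2_eq_2)
  have "word_exp B w \<in> f1 ` L k \<union> f2 ` L (k - 1) \<union> f3 ` L (k - 1)"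
    if w: "set w \<subseteq> {..n}" "length w = k" for w
  proof -
    define d where "d = count (mset (map grp w))"
    define T where "T = sum_list (map tau w)"
    define r where "r = map d [3..<n - 1]"
    have lr: "length r = n - 4" by (simp add: r_def)
    have split: "{..<n - 1} = {0, 1, 2} \<union> {3..<n - 1}" using n by auto
    have "(\<Sum>j\<in>{3..<n - 1}. d j * B ^ j) = R r"
    proof -
      have "(\<Sum>j\<in>{3..<n - 1}. d j * B ^ j) = (\<Sum>j<n - 4. d (j + 3) * B ^ (j + 3))"
        using n by (intro sum.reindex_bij_witness[of _ "\<lambda>j. j + 3" "\<lambda>j. j - 3"]) auto
      then show ?thesis unfolding R_def lr by (simp add: r_def algebra_simps)
    qed
    then have val: "word_exp B w = val T (d 1) (d 2) r"
      unfolding word_exp_digits[OF n w(1)] split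
      by (subst sum.union_disjoint) (auto simp: word_digit_def val_def T_def d_def)
    have sr: "sum_list r = (\<Sum>j\<in>{3..<n - 1}. d j)"
      unfolding r_def by (simp add: interv_sum_list_conv_sum_set_nat)
    have "set_mset (mset (map grp w)) \<subseteq> {1..<n - 1}" using w grp_bounds[OF n] by force
    then have "size (mset (map grp w)) = (\<Sum>j\<in>{1..<n - 1}. d j)"
      unfolding size_multiset_overloaded_eq d_def by (intro sum.mono_neutral_left) (auto simp: not_in_iff simp del: mset_map)
    also have "{1..<n - 1} = {1, 2} \<union> {3..<n - 1}" using n by auto
    also have "(\<Sum>j\<in>{1, 2} \<union> {3..<n - 1}. d j) = d 1 + d 2 + sum_list r"
      unfolding sr by (subst sum.union_disjoint) auto
    finally have k': "k = d 1 + d 2 + sum_list r" using w by simp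
    \<comment> \<open>Every \<open>T \<le> d 1 + 2 * d 2\<close> is uniquely of one of the following shapes, which correspond to the
      monomials outside the initial ideal of the 2 by 2 minors.\<close>
    have "T \<le> d 1 + 2 * d 2" unfolding T_def d_def
      by (induction w) (auto simp: tau_def grp_def)
    then consider (a) s where "T = 2 * s" "s \<le> d 2" | (b) s where "T = 2 * s + 1" "s + 1 \<le> d 2"
      | (c) s where "T = 2 * d 2 + s + 1" "s + 1 \<le> d 1"
    proof -
      assume T: "T \<le> d 1 + 2 * d 2"
      show thesis
      proof (cases "T \<le> 2 * d 2")
        case True
        then show ?thesis using that(1)[of "T div 2"] that(2)[of "T div 2"]
          by (cases "even T") (auto elim!: evenE oddE)
      next
        case False
        then show ?thesis using that(3)[of "T - 2 * d 2 - 1"] T by auto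
      qed
    qed
    then show ?thesis
    proof cases
      case a
      have "word_exp B w = f1 (d 1 # s # (d 2 - s) # r)" using a by (simp add: f1_def val)
      moreover have "d 1 # s # (d 2 - s) # r \<in> L k" using a k' lr n by (auto simp: L_def)
      ultimately have "word_exp B w \<in> f1 ` L k" by (rule image_eqI)
      then show ?thesis by blast
    next
      case b
      have "word_exp B w = f2 (d 1 # s # (d 2 - s - 1) # r)" using b by (simp add: f2_def val)
      moreover have "d 1 # s # (d 2 - s - 1) # r \<in> L (k - 1)" using b k' lr n by (auto simp: L_def)
      ultimately have "word_exp B w \<in> f2 ` L (k - 1)" by (rule image_eqI)
      then show ?thesis by blast
    next
      case c
      have "word_exp B w = f3 (s # (d 1 - s - 1) # d 2 # r)" using c by (simp add: f3_def val)
      moreover have "s # (d 1 - s - 1) # d 2 # r \<in> L (k - 1)" using c k' lr n by (auto simp: L_def)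
      ultimately have "word_exp B w \<in> f3 ` L (k - 1)" by (rule image_eqI)
      then show ?thesis by blast
    qed
  qed
  then have "word_exp B ` {w. set w \<subseteq> {..n} \<and> length w = k} \<subseteq> f1 ` L k \<union> f2 ` L (k - 1) \<union> f3 ` L (k - 1)"
    by blast
  then have "card (word_exp B ` {w. set w \<subseteq> {..n} \<and> length w = k}) \<le>
      card (f1 ` L k \<union> f2 ` L (k - 1) \<union> f3 ` L (k - 1))"
    by (intro card_mono) (auto intro: finL)
  also have "\<dots> \<le> card (f1 ` L k) + card (f2 ` L (k - 1)) + card (f3 ` L (k - 1))"
    by (intro order.trans[OF card_Un_le] add_mono order.refl)
  also have "\<dots> \<le> card (L k) + card (L (k - 1)) + card (L (k - 1))"
    by (intro add_mono card_image_le finL)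
  also have "\<dots> = ((n + k - 2) choose (n - 2)) + 2 * ((n + k - 3) choose (n - 2))"
    using n k binomial_symmetric[of k "n + k - 2"] binomial_symmetric[of "k - 1" "n + k - 3"]
    by (simp add: cardL add.commute numeral_3_eq_3)
  finally show ?thesis .
qed

text \<open>By Pascal's rule the first difference in \<open>f_bound\<close> is the Hilbert function
  plus \<open>2 * (a choose Suc r)\<close>. What is subtracted afterwards reduces to two binomials
  with lower index \<open>Suc r\<close> and upper index at most \<open>a\<close>, so it does not
  exceed this surplus.\<close>

lemma scroll_hilbert_le_f_bound:
  assumes "n \<ge> 4" "k \<ge> 3"
  shows "int (((n + k - 2) choose (n - 2)) + 2 * ((n + k - 3) choose (n - 2))) \<le> f_bound n k"
proof -
  define r a where "r = n - 2" and "a = n + k - 3"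
  have n: "n = Suc (Suc r)" and nk: "n + k = Suc (Suc (Suc a))" "n + k - 2 = Suc a" using assms by (auto simp: r_def a_def)
  have main: "int ((n + k) choose n) - int ((n + k - 2) choose n) =
      int (Suc a choose r) + 2 * int (a choose r) + 2 * int (a choose Suc r)"
    unfolding nk unfolding n by simp
  have H: "int (((n + k - 2) choose (n - 2)) + 2 * ((n + k - 3) choose (n - 2))) =
     int (Suc a choose r) + 2 * int (a choose r)" unfolding nk by (simp add: r_def a_def)
  show ?thesis
  proof (cases "even k")
    case True
    then obtain h where h: "k = 2 * h" "h \<ge> 2" using assms by (auto elim!: evenE)
    have "int ((n + h) choose n) - int ((n - 2 + h) choose n) =
       int ((r + h + 1) choose Suc r) + int ((r + h) choose Suc r)"
      unfolding n by (simp add: add.commute)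
    also have "\<dots> \<le> int (a choose Suc r) + int (a choose Suc r)"
      using h by (intro add_mono of_nat_mono binomial_right_mono) (simp_all add: a_def n del: binomial_Suc_Suc)
    finally show ?thesis using main True unfolding H f_bound_def by (simp add: h(1))
  next
    case False
    then obtain h where h: "k = 2 * h + 1" "h \<ge> 1" using assms by (auto elim!: oddE)
    then obtain g where g: "h = Suc g" by (cases h) auto
    have "int ((n + h) choose n) - int ((n + g) choose n) = int ((r + g + 2) choose Suc r)"
      unfolding n g by (simp add: add.commute)
    also have "\<dots> \<le> int (a choose Suc r)"
      using h g by (intro of_nat_mono binomial_right_mono) (simp add: a_def n)
    finally show ?thesis using main False unfolding H f_bound_def by (simp add: h(1) g)
  qed
qed

lemma le_binomial: "0 < r \<Longrightarrow> r < m \<Longrightarrow> m \<le> m choose r"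
proof (induction m arbitrary: r)
  case (Suc m)
  obtain s where s: "r = Suc s" using Suc.prems by (cases r) auto
  show ?case
  proof (cases "r = m")
    case False
    then have "m \<le> m choose r" using Suc by auto
    moreover have "0 < m choose s" using Suc.prems s by (intro zero_less_binomial) auto
    ultimately show ?thesis unfolding s binomial_Suc_Suc by linarith
  qed simp
qed simp

section \<open>Linear functionals on polynomials\<close>

abbreviation mon :: "monomial \<Rightarrow> 'k::comm_ring_1 \<Rightarrow> 'k mpoly" where
  "mon m c \<equiv> Poly_Mapping.single m c"

abbreviation unit_exp :: "nat \<Rightarrow> monomial" where
  "unit_exp i \<equiv> Poly_Mapping.single i (Suc 0)"

definition lin_form :: "nat \<Rightarrow> (nat \<Rightarrow> 'k::comm_ring_1) \<Rightarrow> 'k mpoly" where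
  "lin_form n p = (\<Sum>i\<le>n. mon (unit_exp i) (p i))"

text \<open>A functional is given by arbitrary values \<open>\<psi>\<close> on the monomials,
  without a finiteness condition; evaluation at a point and the dual polynomials below are both of
  this kind.\<close>

definition pairing :: "(monomial \<Rightarrow> 'k) \<Rightarrow> ('k::comm_ring_1) mpoly \<Rightarrow> 'k" where
  "pairing \<psi> q = (\<Sum>m\<in>Poly_Mapping.keys q. Poly_Mapping.lookup q m * \<psi> m)"

lemma pairing_superset:
  assumes "finite S" "Poly_Mapping.keys q \<subseteq> S"
  shows "pairing \<psi> q = (\<Sum>m\<in>S. Poly_Mapping.lookup q m * \<psi> m)"
  unfolding pairing_def using assms by (intro sum.mono_neutral_left) (auto simp: in_keys_iff)

lemma pairing_add: "pairing \<psi> (p + q) = pairing \<psi> p + pairing \<psi> q"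
proof -
  let ?S = "Poly_Mapping.keys p \<union> Poly_Mapping.keys q"
  have "pairing \<psi> r = (\<Sum>m\<in>?S. Poly_Mapping.lookup r m * \<psi> m)"
    if "r \<in> {p, q, p + q}" for r
    using that Poly_Mapping.keys_add[of p q] by (intro pairing_superset) auto
  then show ?thesis by (simp add: lookup_add ring_distribs sum.distrib)
qed

lemma pairing_single [simp]: "pairing \<psi> (mon m c) = c * \<psi> m"
  by (simp add: pairing_def)

lemma pairing_zero [simp]: "pairing \<psi> 0 = 0"
  by (simp add: pairing_def)

lemma pairing_sum: "pairing \<psi> (\<Sum>i\<in>A. f i) = (\<Sum>i\<in>A. pairing \<psi> (f i))"
  by (induction A rule: infinite_finite_induct) (auto simp: pairing_add)

lemma pairing_uminus: "pairing \<psi> (- q) = - pairing \<psi> q"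
  using pairing_add[of \<psi> q "- q"] by (simp add: eq_neg_iff_add_eq_0 add.commute)

lemma pairing_diff: "pairing \<psi> (p - q) = pairing \<psi> p - pairing \<psi> q"
  using pairing_add[of \<psi> p "- q"] by (simp add: pairing_uminus)

lemma mpoly_eq_sum_mon: "q = (\<Sum>m\<in>Poly_Mapping.keys q. mon m (Poly_Mapping.lookup q m))"
  by (rule poly_mapping_eqI) (simp add: lookup_sum lookup_single when_def not_in_keys_iff_lookup_eq_zero)

lemma pairing_mon_mult: "pairing \<psi> (mon a c * q) = c * pairing (\<lambda>m. \<psi> (a + m)) q"
proof -
  have "pairing \<psi> (mon a c * q) = pairing \<psi> (\<Sum>m\<in>Poly_Mapping.keys q. mon a c * mon m (Poly_Mapping.lookup q m))"
    by (subst mpoly_eq_sum_mon[of q]) (simp add: sum_distrib_left)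
  also have "\<dots> = c * pairing (\<lambda>m. \<psi> (a + m)) q"
    by (simp add: pairing_sum mult_single pairing_def[of _ q] sum_distrib_left mult.assoc)
  finally show ?thesis .
qed

section \<open>Degrees of monomials and evaluation at points\<close>

lemma mdeg_eq_sum: "finite S \<Longrightarrow> Poly_Mapping.keys m \<subseteq> S \<Longrightarrow> mdeg m = (\<Sum>i\<in>S. Poly_Mapping.lookup m i)"
  unfolding mdeg_def by (intro sum.mono_neutral_left) (auto simp: in_keys_iff)

lemma keys_add_monomial: "Poly_Mapping.keys (a + b :: monomial) = Poly_Mapping.keys a \<union> Poly_Mapping.keys b"
  by (auto simp: in_keys_iff lookup_add)

lemma mdeg_add: "mdeg (a + b) = mdeg a + mdeg b"
proof -
  let ?S = "Poly_Mapping.keys a \<union> Poly_Mapping.keys b"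
  have "mdeg r = (\<Sum>i\<in>?S. Poly_Mapping.lookup r i)" if "r \<in> {a, b, a + b}" for r
    using that by (intro mdeg_eq_sum) (auto simp: keys_add_monomial)
  then show ?thesis by (simp add: lookup_add sum.distrib)
qed

lemma mdeg_unit_exp [simp]: "mdeg (unit_exp i) = 1"
  by (simp add: mdeg_def)

lemma mdeg_eq_0_iff: "mdeg m = 0 \<longleftrightarrow> m = 0"
proof -
  have "mdeg m = 0 \<longleftrightarrow> Poly_Mapping.keys m = {}"
    unfolding mdeg_def sum_eq_0_iff[OF finite_keys] by (auto simp only: in_keys_iff)
  then show ?thesis by simp
qed

lemma mdeg_eq_1_iff: "mdeg m = 1 \<longleftrightarrow> (\<exists>i. m = unit_exp i)"
proof
  assume m: "mdeg m = 1"
  then have "m \<noteq> 0" using mdeg_eq_0_iff[of m] by auto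
  then obtain i where i: "Poly_Mapping.lookup m i \<noteq> 0" by (auto simp: poly_mapping_eq_iff fun_eq_iff)
  have "unit_exp i + (m - unit_exp i) = m"
    using i by (intro poly_mapping_eqI) (auto simp: lookup_add lookup_minus lookup_single when_def)
  moreover from this have "mdeg (m - unit_exp i) = 0"
    using m mdeg_add[of "unit_exp i" "m - unit_exp i"] by simp
  ultimately show "\<exists>i. m = unit_exp i" by (metis mdeg_eq_0_iff add.right_neutral)
qed auto

definition mon_eval :: "(nat \<Rightarrow> 'k) \<Rightarrow> monomial \<Rightarrow> 'k::comm_ring_1" where
  "mon_eval a m = (\<Prod>i\<in>Poly_Mapping.keys m. a i ^ Poly_Mapping.lookup m i)"

lemma mon_eval_superset:
  assumes "finite S" "Poly_Mapping.keys m \<subseteq> S"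
  shows "mon_eval a m = (\<Prod>i\<in>S. a i ^ Poly_Mapping.lookup m i)"
  unfolding mon_eval_def using assms by (intro prod.mono_neutral_left) (auto simp: in_keys_iff)

lemma mon_eval_add: "mon_eval a (m + m') = mon_eval a m * mon_eval a m'"
proof -
  let ?S = "Poly_Mapping.keys m \<union> Poly_Mapping.keys m'"
  have "mon_eval a r = (\<Prod>i\<in>?S. a i ^ Poly_Mapping.lookup r i)" if "r \<in> {m, m', m + m'}" for r
    using that by (intro mon_eval_superset) (auto simp: keys_add_monomial)
  then show ?thesis by (simp add: lookup_add power_add prod.distrib)
qed

lemma eval_mpoly_pairing: "eval_mpoly a = pairing (mon_eval a)"
  by (rule ext) (simp add: eval_mpoly_def pairing_def mon_eval_def)

lemma eval_mpoly_mult: "eval_mpoly a (p * q) = eval_mpoly a p * eval_mpoly a q"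
proof -
  have mon: "eval_mpoly a (mon m c * q) = c * mon_eval a m * eval_mpoly a q" for m c
    unfolding eval_mpoly_pairing pairing_mon_mult mon_eval_add
    by (simp add: pairing_def sum_distrib_left algebra_simps)
  have "eval_mpoly a (p * q) = eval_mpoly a (\<Sum>m\<in>Poly_Mapping.keys p. mon m (Poly_Mapping.lookup p m) * q)"
    by (subst mpoly_eq_sum_mon[of p]) (simp add: sum_distrib_right)
  also have "\<dots> = (\<Sum>m\<in>Poly_Mapping.keys p. eval_mpoly a (mon m (Poly_Mapping.lookup p m) * q))"
    by (simp add: eval_mpoly_pairing pairing_sum)
  also have "\<dots> = eval_mpoly a p * eval_mpoly a q"
    unfolding mon by (simp add: eval_mpoly_pairing pairing_def sum_distrib_right)
  finally show ?thesis .
qed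

lemma eval_mpoly_diff: "eval_mpoly a (p - q) = eval_mpoly a p - eval_mpoly a q"
  by (simp add: eval_mpoly_pairing pairing_diff)

lemma eval_mpoly_unit_exp [simp]: "eval_mpoly a (mon (unit_exp i) c) = c * a i"
  by (simp add: eval_mpoly_def)

lemma eval_mpoly_one [simp]: "eval_mpoly a 1 = 1"
  using eval_mpoly_mult[of a 1 1] by (simp add: eval_mpoly_def)

lemma eval_mpoly_power: "eval_mpoly a (p ^ k) = eval_mpoly a p ^ k"
  by (induction k) (auto simp: eval_mpoly_mult)

lemma eval_lin_form: "eval_mpoly a (lin_form n p) = (\<Sum>i\<le>n. p i * a i)"
  unfolding lin_form_def by (simp add: eval_mpoly_pairing pairing_sum flip: eval_mpoly_unit_exp)

section \<open>Functionals and products of linear forms\<close>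

text \<open>Up to factorials, a function \<open>\<psi>\<close> on monomials is a dual polynomial: \<open>raise\<close> multiplies it by the
  linear form with coefficients \<open>v\<close>, \<open>shift\<close> differentiates it in the direction \<open>p\<close>, and
  \<open>shift_raise\<close> is the product rule.\<close>

definition shift :: "nat \<Rightarrow> (nat \<Rightarrow> 'k) \<Rightarrow> (monomial \<Rightarrow> 'k) \<Rightarrow> monomial \<Rightarrow> 'k::comm_ring_1" where
  "shift n p \<psi> m = (\<Sum>i\<le>n. p i * \<psi> (m + unit_exp i))"

definition raise :: "nat \<Rightarrow> (nat \<Rightarrow> 'k) \<Rightarrow> (monomial \<Rightarrow> 'k) \<Rightarrow> monomial \<Rightarrow> 'k::comm_ring_1" where
  "raise n v \<psi> m = (\<Sum>i\<le>n. of_nat (Poly_Mapping.lookup m i) * v i * \<psi> (m - unit_exp i))"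

definition dot :: "nat \<Rightarrow> (nat \<Rightarrow> 'k) \<Rightarrow> (nat \<Rightarrow> 'k) \<Rightarrow> 'k::comm_ring_1" where
  "dot n p v = (\<Sum>i\<le>n. p i * v i)"

text \<open>Multiplication by a linear form is adjoint to \<open>shift\<close>, so instead of
  multiplying the argument one can differentiate the functional.\<close>

lemma pairing_lin_form_mult: "pairing \<psi> (lin_form n p * q) = pairing (shift n p \<psi>) q"
proof -
  have "pairing \<psi> (lin_form n p * q) = (\<Sum>i\<le>n. p i * pairing (\<lambda>m. \<psi> (unit_exp i + m)) q)"
    by (simp add: lin_form_def sum_distrib_right pairing_sum pairing_mon_mult)
  also have "\<dots> = pairing (shift n p \<psi>) q"
    unfolding pairing_def shift_def sum_distrib_left
    by (subst sum.swap) (simp add: algebra_simps)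
  finally show ?thesis .
qed

lemma pairing_lin_form_power_mult:
  "pairing \<psi> (lin_form n p ^ k * q) = pairing ((shift n p ^^ k) \<psi>) q"
proof (induction k arbitrary: q)
  case (Suc k)
  have "lin_form n p ^ Suc k * q = lin_form n p ^ k * (lin_form n p * q)" by (simp add: algebra_simps)
  then show ?case by (simp only: Suc pairing_lin_form_mult funpow.simps comp_def)
qed simp

lemma shift_raise: "shift n p (raise n v \<psi>) m = raise n v (shift n p \<psi>) m + dot n p v * \<psi> m"
proof -
  \<comment> \<open>Subtraction of exponents is truncated, so the two arguments of
    \<open>\<psi>\<close> are sure to agree only if variable \<open>j\<close> occurs in
    \<open>m\<close>; otherwise the factor \<open>lookup m j\<close> is 0.\<close>
  have exch: "of_nat (Poly_Mapping.lookup m j) * v j * \<psi> (m + unit_exp i - unit_exp j) =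
      of_nat (Poly_Mapping.lookup m j) * v j * \<psi> (m - unit_exp j + unit_exp i)" for i j
  proof (cases "Poly_Mapping.lookup m j = 0")
    case False
    then have "m + unit_exp i - unit_exp j = m - unit_exp j + unit_exp i"
      by (intro poly_mapping_eqI) (auto simp: lookup_add lookup_minus lookup_single when_def)
    then show ?thesis by simp
  qed simp
  have inner: "raise n v \<psi> (m + unit_exp i) =
      (\<Sum>j\<le>n. of_nat (Poly_Mapping.lookup m j) * v j * \<psi> (m - unit_exp j + unit_exp i)) + v i * \<psi> m"
    if "i \<le> n" for i
  proof -
    have "raise n v \<psi> (m + unit_exp i) =
      (\<Sum>j\<le>n. of_nat (Poly_Mapping.lookup m j) * v j * \<psi> (m + unit_exp i - unit_exp j)
         + (if j = i then v i * \<psi> m else 0))"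
      unfolding raise_def by (intro sum.cong refl) (auto simp: lookup_add lookup_single ring_distribs)
    then show ?thesis using that by (simp only: exch sum.distrib) simp
  qed
  have "shift n p (raise n v \<psi>) m =
      (\<Sum>i\<le>n. \<Sum>j\<le>n. p i * (of_nat (Poly_Mapping.lookup m j) * v j * \<psi> (m - unit_exp j + unit_exp i))) + dot n p v * \<psi> m"
    unfolding shift_def[of n p "raise n v \<psi>"] dot_def
    by (simp add: inner ring_distribs sum.distrib sum_distrib_left sum_distrib_right mult.assoc)
  also have "(\<Sum>i\<le>n. \<Sum>j\<le>n. p i * (of_nat (Poly_Mapping.lookup m j) * v j * \<psi> (m - unit_exp j + unit_exp i)))
      = raise n v (shift n p \<psi>) m"
    unfolding raise_def shift_def sum_distrib_left by (subst sum.swap) (simp add: algebra_simps)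
  finally show ?thesis .
qed

lemma shift_add_scale: "shift n p (\<lambda>m. f m + c * g m) = (\<lambda>m. shift n p f m + c * shift n p g m)"
  by (rule ext) (simp add: shift_def ring_distribs sum.distrib sum_distrib_left algebra_simps)

lemma shift_zero [simp]: "shift n p (\<lambda>_. 0) = (\<lambda>_. 0)"
  by (rule ext) (simp add: shift_def)

lemma raise_zero [simp]: "raise n v (\<lambda>_. 0) = (\<lambda>_. 0)"
  by (rule ext) (simp add: raise_def)

text \<open>The iterated Leibniz rule: the factor \<open>v\<close> is linear, so it is
  differentiated at most once, in any of the \<open>Suc j\<close> steps.\<close>

lemma shift_power_raise:
  "(shift n p ^^ Suc j) (raise n v \<psi>) =
     (\<lambda>m. raise n v ((shift n p ^^ Suc j) \<psi>) m + of_nat (Suc j) * dot n p v * (shift n p ^^ j) \<psi> m)"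
proof (induction j)
  case 0
  show ?case by (rule ext) (simp add: shift_raise)
next
  case (Suc j)
  have "(shift n p ^^ Suc (Suc j)) (raise n v \<psi>) = shift n p ((shift n p ^^ Suc j) (raise n v \<psi>))" by simp
  also have "\<dots> = (\<lambda>m. shift n p (raise n v ((shift n p ^^ Suc j) \<psi>)) m
      + of_nat (Suc j) * dot n p v * (shift n p ^^ Suc j) \<psi> m)"
    unfolding Suc shift_add_scale by simp
  also have "\<dots> = (\<lambda>m. raise n v ((shift n p ^^ Suc (Suc j)) \<psi>) m
      + of_nat (Suc (Suc j)) * dot n p v * (shift n p ^^ Suc j) \<psi> m)"
    by (rule ext) (simp add: shift_raise algebra_simps)
  finally show ?case .
qed

definition const_coeff :: "monomial \<Rightarrow> 'k::comm_ring_1" where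
  "const_coeff m = (if m = 0 then 1 else 0)"

text \<open>As a dual polynomial this is the product of the linear forms with coefficient vectors
  \<open>vs\<close>; \<open>const_coeff\<close> stands for the constant 1.\<close>

definition product_functional :: "nat \<Rightarrow> (nat \<Rightarrow> 'k) list \<Rightarrow> monomial \<Rightarrow> 'k::comm_ring_1" where
  "product_functional n vs = foldr (raise n) vs const_coeff"

lemma shift_const_coeff [simp]: "shift n p const_coeff = (\<lambda>_. 0)"
proof -
  have "m + unit_exp i \<noteq> 0" for m i
    using mdeg_add[of m "unit_exp i"] by (auto simp flip: mdeg_eq_0_iff)
  then show ?thesis by (intro ext) (simp add: shift_def const_coeff_def)
qed

lemma pairing_const_coeff: "pairing (\<lambda>m. c * const_coeff m) q = c * Poly_Mapping.lookup q 0"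
proof -
  have "pairing (\<lambda>m. c * const_coeff m) q = (\<Sum>m\<in>insert 0 (Poly_Mapping.keys q). if m = 0 then c * Poly_Mapping.lookup q 0 else 0)"
    by (subst pairing_superset[of "insert 0 (Poly_Mapping.keys q)"]) (auto simp: const_coeff_def if_distrib cong: if_cong)
  then show ?thesis by simp
qed

text \<open>Differentiating a form of degree \<open>d\<close> in direction \<open>p\<close> gives
  \<open>fact d\<close> times its value at \<open>p\<close> after \<open>d\<close> steps and 0 after
  one more. Both parts share one induction because the first for \<open>v # vs\<close> needs the
  second for \<open>vs\<close>.\<close>

lemma shift_power_product_functional:
  "(shift n p ^^ length vs) (product_functional n vs) =
     (\<lambda>m. fact (length vs) * prod_list (map (dot n p) vs) * const_coeff m)"
  "(shift n p ^^ Suc (length vs)) (product_functional n vs) = (\<lambda>_. 0)"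
proof (induction vs)
  case Nil
  {
    case 1 show ?case by (simp add: product_functional_def)
  next
    case 2 show ?case by (simp add: product_functional_def)
  }
next
  case (Cons v vs)
  have pf: "product_functional n (v # vs) = raise n v (product_functional n vs)"
    by (simp add: product_functional_def)
  show 1: "(shift n p ^^ length (v # vs)) (product_functional n (v # vs)) =
     (\<lambda>m. fact (length (v # vs)) * prod_list (map (dot n p) (v # vs)) * const_coeff m)"
    unfolding pf length_Cons shift_power_raise Cons by (simp add: algebra_simps)
  have "(shift n p ^^ Suc (length (v # vs))) (product_functional n (v # vs)) =
     shift n p ((shift n p ^^ length (v # vs)) (product_functional n (v # vs)))" by simp
  also have "\<dots> = (\<lambda>_. 0)" unfolding 1
    using shift_add_scale[of n p "\<lambda>_. 0" "fact (length (v # vs)) * prod_list (map (dot n p) (v # vs))" const_coeff]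
    by simp
  finally show "(shift n p ^^ Suc (length (v # vs))) (product_functional n (v # vs)) = (\<lambda>_. 0)" .
qed

text \<open>Apolarity: against a \<open>k\<close>-th power of a linear form the functional evaluates
  the product of the \<open>vs\<close> at the point \<open>p\<close>. After \<open>k\<close>
  differentiations it sees only the constant term of \<open>q\<close>.\<close>

lemma pairing_product_functional_power:
  assumes "length vs = k"
  shows "pairing (product_functional n vs) (lin_form n p ^ k * q) =
    fact k * prod_list (map (dot n p) vs) * Poly_Mapping.lookup q 0"
  unfolding pairing_lin_form_power_mult assms[symmetric] shift_power_product_functional(1) pairing_const_coeff ..

text \<open>If all factors vanish at \<open>p\<close>, their product is a cone with vertex
  \<open>p\<close>, so its derivative in direction \<open>p\<close> is 0.\<close>

lemma pairing_product_functional_lin_form: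
  assumes "\<And>v. v \<in> set vs \<Longrightarrow> dot n p v = 0"
  shows "pairing (product_functional n vs) (lin_form n p * q) = 0"
proof -
  have "shift n p (product_functional n vs) = (\<lambda>_. 0)"
    using assms
  proof (induction vs)
    case (Cons v vs)
    then show ?case
      by (intro ext) (simp add: product_functional_def shift_raise[of n p v])
  qed (simp add: product_functional_def)
  then show ?thesis by (simp add: pairing_lin_form_mult) (simp add: pairing_def)
qed

section \<open>Ideals and quotients of the polynomial ring\<close>

lemma mpoly_ring_simps [simp]:
  "mult (mpoly_ring n) = (*)" "one (mpoly_ring n) = 1" "zero (mpoly_ring n) = 0" "add (mpoly_ring n) = (+)"
  by (simp_all add: mpoly_ring_def)

lemma mem_carrier_iff: "q \<in> carrier (mpoly_ring n) \<longleftrightarrow> (\<forall>m\<in>Poly_Mapping.keys q. Poly_Mapping.keys m \<subseteq> {..n})"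
  by (simp add: mpoly_ring_def)

lemma carrier_uminus: "p \<in> carrier (mpoly_ring n) \<Longrightarrow> - p \<in> carrier (mpoly_ring n)"
  by (simp add: mem_carrier_iff)

lemma carrier_closed:
  assumes "p \<in> carrier (mpoly_ring n)" "q \<in> carrier (mpoly_ring n)"
  shows "p + q \<in> carrier (mpoly_ring n)" "p * q \<in> carrier (mpoly_ring n)" "p - q \<in> carrier (mpoly_ring n)"
proof -
  interpret cring "mpoly_ring n :: 'a mpoly ring" by (rule cring_mpoly_ring)
  show "p + q \<in> carrier (mpoly_ring n)" "p * q \<in> carrier (mpoly_ring n)"
    using a_closed[OF assms] m_closed[OF assms] by simp_all
  show "p - q \<in> carrier (mpoly_ring n)" using a_closed[OF assms(1) carrier_uminus[OF assms(2)]] by simp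
qed

lemma carrier_mon: "Poly_Mapping.keys m \<subseteq> {..n} \<Longrightarrow> mon m c \<in> carrier (mpoly_ring n)"
  by (simp add: mem_carrier_iff)

lemma carrier_01 [simp]: "0 \<in> carrier (mpoly_ring n)" "1 \<in> carrier (mpoly_ring n)"
  by (simp_all add: mem_carrier_iff)

lemma carrier_power: "p \<in> carrier (mpoly_ring n) \<Longrightarrow> p ^ k \<in> carrier (mpoly_ring n)"
  by (induction k) (auto intro: carrier_closed)

lemma carrier_sum: "(\<And>i. i \<in> A \<Longrightarrow> f i \<in> carrier (mpoly_ring n)) \<Longrightarrow> sum f A \<in> carrier (mpoly_ring n)"
  by (induction A rule: infinite_finite_induct) (auto intro: carrier_closed)

lemma minus_mpoly_ring:
  assumes "p \<in> carrier (mpoly_ring n)" "q \<in> carrier (mpoly_ring n)"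
  shows "p \<ominus>\<^bsub>mpoly_ring n\<^esub> q = p - q"
proof -
  interpret cring "mpoly_ring n :: 'a mpoly ring" by (rule cring_mpoly_ring)
  have "\<ominus>\<^bsub>mpoly_ring n\<^esub> q = - q"
    using minus_equality[of "- q" q] assms carrier_uminus[OF assms(2)] by simp
  then show ?thesis by (simp add: a_minus_def)
qed

lemma ideal_mpolyI:
  fixes I :: "('k::comm_ring_1) mpoly set"
  assumes "I \<subseteq> carrier (mpoly_ring n)" "0 \<in> I"
    and add: "\<And>p q. p \<in> I \<Longrightarrow> q \<in> I \<Longrightarrow> p + q \<in> I"
    and mult: "\<And>p q. p \<in> I \<Longrightarrow> q \<in> carrier (mpoly_ring n) \<Longrightarrow> q * p \<in> I"
  shows "ideal I (mpoly_ring n)"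
proof -
  interpret cring "mpoly_ring n :: 'k mpoly ring" by (rule cring_mpoly_ring)
  show ?thesis
  proof (rule idealI)
    show "subgroup I (add_monoid (mpoly_ring n))"
    proof (rule group.subgroupI[OF a_group])
      fix p assume p: "p \<in> I"
      have "- 1 * p \<in> I" by (rule mult[OF p]) (simp add: carrier_uminus)
      moreover have "inv\<^bsub>add_monoid (mpoly_ring n)\<^esub> p = - p"
        using minus_equality[of "- p" p] p assms(1) carrier_uminus[of p n]
        by (auto simp: a_inv_def)
      ultimately show "inv\<^bsub>add_monoid (mpoly_ring n)\<^esub> p \<in> I" by simp
    qed (use assms in auto)
  qed (use mult ring_axioms in \<open>auto simp: mult.commute\<close>)
qed

lemma ideal_mpolyD:
  fixes I :: "('k::comm_ring_1) mpoly set"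
  assumes "ideal I (mpoly_ring n)"
  shows "I \<subseteq> carrier (mpoly_ring n)" "0 \<in> I" "p \<in> I \<Longrightarrow> q \<in> I \<Longrightarrow> p + q \<in> I"
    "p \<in> I \<Longrightarrow> q \<in> carrier (mpoly_ring n) \<Longrightarrow> q * p \<in> I"
    "p \<in> I \<Longrightarrow> q \<in> I \<Longrightarrow> p - q \<in> I"
proof -
  interpret I: ideal I "mpoly_ring n" by fact
  show sub: "I \<subseteq> carrier (mpoly_ring n)" by (rule I.a_subset)
  show "0 \<in> I" using additive_subgroup.zero_closed[OF I.additive_subgroup_axioms] by simp
  have add: "p \<in> I \<Longrightarrow> q \<in> I \<Longrightarrow> p + q \<in> I" for p q
    using additive_subgroup.a_closed[OF I.additive_subgroup_axioms, of p q] by simp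
  then show "p \<in> I \<Longrightarrow> q \<in> I \<Longrightarrow> p + q \<in> I" .
  have mult: "p \<in> I \<Longrightarrow> q \<in> carrier (mpoly_ring n) \<Longrightarrow> q * p \<in> I" for p q using I.I_l_closed by simp
  then show "p \<in> I \<Longrightarrow> q \<in> carrier (mpoly_ring n) \<Longrightarrow> q * p \<in> I" .
  have "- 1 * q \<in> I" if "q \<in> I" for q by (rule mult[OF that]) (simp add: carrier_uminus)
  then show "p \<in> I \<Longrightarrow> q \<in> I \<Longrightarrow> p - q \<in> I"
    using add[of p "- q"] by simp
qed

lemma ideal_sum:
  "ideal I (mpoly_ring n) \<Longrightarrow> (\<And>i. i \<in> A \<Longrightarrow> f i \<in> I) \<Longrightarrow> (sum f A :: 'k::comm_ring_1 mpoly) \<in> I"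
  by (induction A rule: infinite_finite_induct) (auto simp: ideal_mpolyD)

text \<open>Scalars act through the constant polynomials \<open>mon 0 c\<close>; this gives access
  to span, independence and dimension for polynomials.\<close>

interpretation mpoly_space: vector_space "\<lambda>(c::'k::field) (p::'k mpoly). mon 0 c * p"
  by unfold_locales (auto simp: algebra_simps mult_single single_add simp flip: mult.assoc)

text \<open>A maximal independent subset of \<open>S\<close> stays independent when \<open>x\<close>
  is added, so some linear map vanishes on it and is 1 at \<open>x\<close>; its values on monomials
  are \<open>\<psi>\<close>. Membership in a span thereby becomes a question about
  functionals.\<close>

lemma separating_functional:
  fixes x :: "'k::field mpoly"
  assumes "x \<notin> mpoly_space.span S"
  shows "\<exists>\<psi>. (\<forall>s\<in>S. pairing \<psi> s = 0) \<and> pairing \<psi> x = 1"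
proof -
  interpret field_space: vector_space "(*) :: 'k \<Rightarrow> 'k \<Rightarrow> 'k"
    by unfold_locales (auto simp: algebra_simps)
  interpret vector_space_pair "\<lambda>(c::'k) (p::'k mpoly). mon 0 c * p" "(*) :: 'k \<Rightarrow> 'k \<Rightarrow> 'k" ..
  obtain B where B: "B \<subseteq> S" "mpoly_space.independent B" "S \<subseteq> mpoly_space.span B"
    using mpoly_space.maximal_independent_subset by blast
  have "x \<notin> mpoly_space.span B" using assms B(1) mpoly_space.span_mono by blast
  then have ind: "mpoly_space.independent (insert x B)" and "x \<notin> B"
    using mpoly_space.independent_insertI B(2) mpoly_space.span_base by blast+
  obtain g where g: "Vector_Spaces.linear (\<lambda>c p. mon 0 c * p) (*) g" "\<And>y. y \<in> insert x B \<Longrightarrow> g y = (if y = x then 1 else 0)"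
    using linear_independent_extend[OF ind, of "\<lambda>y. if y = x then 1 else 0"] by blast
  have "g y = 0" if "y \<in> B" for y using g(2)[of y] that \<open>x \<notin> B\<close> by auto
  then have "g s = 0" if "s \<in> S" for s
    using linear_eq_0_on_span[OF g(1), of B s] B(3) that by blast
  moreover have "pairing (\<lambda>m. g (mon m 1)) q = g q" for q
  proof -
    have "g q = g (\<Sum>m\<in>Poly_Mapping.keys q. mon 0 (Poly_Mapping.lookup q m) * mon m 1)"
      by (subst mpoly_eq_sum_mon[of q]) (simp add: mult_single)
    also have "\<dots> = pairing (\<lambda>m. g (mon m 1)) q"
      unfolding linear_sum[OF g(1)] linear_scale[OF g(1)] pairing_def ..
    finally show ?thesis by simp
  qed
  ultimately show ?thesis using g(2) by (intro exI[of _ "\<lambda>m. g (mon m 1)"]) auto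
qed

section \<open>Spans and nilpotency modulo an ideal\<close>

lemma span_subset_ideal:
  assumes "ideal I (mpoly_ring n)" "S \<subseteq> I"
  shows "mpoly_space.span S \<subseteq> I"
  using assms by (intro mpoly_space.span_minimal mpoly_space.subspaceI)
    (auto simp: ideal_mpolyD intro!: ideal_mpolyD(4) carrier_mon)

text \<open>In each term of the binomial expansion either \<open>p\<close> has exponent at least
  \<open>e\<close> or \<open>q\<close> has exponent at least \<open>f\<close>.\<close>

lemma nilpotent_add:
  fixes p q :: "'k::comm_ring_1 mpoly"
  assumes I: "ideal I (mpoly_ring n)" and c: "p \<in> carrier (mpoly_ring n)" "q \<in> carrier (mpoly_ring n)"
    and "p ^ e \<in> I" "q ^ f \<in> I"
  shows "(p + q) ^ (e + f) \<in> I"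
  unfolding binomial_ring
proof (rule ideal_sum[OF I])
  fix i assume "i \<in> {..e + f}"
  have nat: "of_nat b \<in> carrier (mpoly_ring n)" for b
    by (metis single_of_nat carrier_mon keys_zero empty_subsetI)
  show "of_nat (e + f choose i) * p ^ i * q ^ (e + f - i) \<in> I"
  proof (cases "e \<le> i")
    case True
    then have "p ^ i = p ^ (i - e) * p ^ e" by (simp flip: power_add)
    then have "of_nat (e + f choose i) * p ^ i * q ^ (e + f - i) =
        (of_nat (e + f choose i) * p ^ (i - e) * q ^ (e + f - i)) * p ^ e"
      by (simp only: ac_simps)
    then show ?thesis
      by (simp only:) (intro ideal_mpolyD(4)[OF I assms(4)] carrier_closed carrier_power c nat)
  next
    case False
    then have "q ^ (e + f - i) = q ^ (e - i) * q ^ f" by (simp flip: power_add)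
    then have "of_nat (e + f choose i) * p ^ i * q ^ (e + f - i) =
        (of_nat (e + f choose i) * p ^ i * q ^ (e - i)) * q ^ f"
      by (simp only: ac_simps)
    then show ?thesis
      by (simp only:) (intro ideal_mpolyD(4)[OF I assms(5)] carrier_closed carrier_power c nat)
  qed
qed

text \<open>The elements with a power in \<open>I\<close> form a subspace, so it suffices to check a
  spanning set.\<close>

lemma nilpotent_span:
  fixes I :: "'k::field mpoly set"
  assumes I: "ideal I (mpoly_ring n)" and S: "S \<subseteq> carrier (mpoly_ring n)" "\<And>s. s \<in> S \<Longrightarrow> \<exists>e. s ^ e \<in> I"
    and x: "x \<in> mpoly_space.span S"
  shows "\<exists>e. x ^ e \<in> I"
proof -
  let ?V = "{y \<in> carrier (mpoly_ring n). \<exists>e. y ^ e \<in> I}"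
  have "mpoly_space.subspace ?V"
  proof (rule mpoly_space.subspaceI)
    show "0 \<in> ?V" using ideal_mpolyD(2)[OF I] by (auto intro!: exI[of _ 1])
    show "p + q \<in> ?V" if "p \<in> ?V" "q \<in> ?V" for p q
      using that nilpotent_add[OF I] by (blast intro: carrier_closed)
    show "mon 0 c * p \<in> ?V" if p: "p \<in> ?V" for c p
    proof -
      have "mon 0 c \<in> carrier (mpoly_ring n)" by (rule carrier_mon) simp
      then show ?thesis using p
        by (auto simp: power_mult_distrib intro: ideal_mpolyD(4)[OF I] carrier_power carrier_closed)
    qed
  qed
  then have "mpoly_space.span S \<subseteq> ?V" using S by (intro mpoly_space.span_minimal) auto
  then show ?thesis using x by blast
qed

section \<open>Descending chains and artinian quotients\<close>

lemma (in vector_space) decreasing_subspaces_stabilize: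
  assumes "finite B" and U: "\<And>m::nat. subspace (U m)" "\<And>m. U m \<subseteq> span B" "\<And>m. U (Suc m) \<subseteq> U m"
  shows "\<exists>M. \<forall>m\<ge>M. U m = U M"
proof -
  \<comment> \<open>\<open>M\<close> minimizes the dimension along the chain; a proper subspace
    further down would have smaller dimension.\<close>
  obtain M where M: "\<And>m. dim (U M) \<le> dim (U m)"
    using ex_has_least_nat[of "\<lambda>_. True" undefined "\<lambda>m. dim (U m)"] by blast
  have "U m = U M" if "m \<ge> M" for m
  proof
    show sub: "U m \<subseteq> U M" using lift_Suc_antimono_le[of U, OF U(3) that] .
    show "U M \<subseteq> U m"
    proof
      fix x assume x: "x \<in> U M"
      obtain b where b: "b \<subseteq> U m" "independent b" "U m \<subseteq> span b" "card b = dim (U m)"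
        using basis_exists by blast
      obtain c where c: "c \<subseteq> U M" "independent c" "U M \<subseteq> span c" "card c = dim (U M)"
        using basis_exists by blast
      have fin: "finite b" "finite c"
        using independent_span_bound[OF assms(1)] b(1,2) c(1,2) U(2) by blast+
      show "x \<in> U m"
      proof (rule ccontr)
        assume "x \<notin> U m"
        then have "x \<notin> span b" using span_minimal[OF b(1) U(1)] by blast
        then have "independent (insert x b)" "x \<notin> b" using independent_insertI b(2) span_base by blast+
        moreover have "insert x b \<subseteq> span c" using x b(1) sub c(3) by blast
        ultimately have "card (insert x b) \<le> card c" using independent_span_bound[OF fin(2)] by blast
        then show False using M[of m] b(4) c(4) fin(1) \<open>x \<notin> b\<close> by simp
      qed
    qed
  qed
  then show ?thesis by blast
qed

lemma var_power: "mon (unit_exp i) 1 ^ e = mon (Poly_Mapping.single i e) 1"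
  by (induction e) (simp_all add: mult_single single_add[symmetric] single_one[symmetric] del: single_one)

lemma coset_eq_iff:
  fixes I :: "'k::comm_ring_1 mpoly set"
  assumes "ideal I (mpoly_ring n)" "p \<in> carrier (mpoly_ring n)" "q \<in> carrier (mpoly_ring n)"
  shows "I +>\<^bsub>mpoly_ring n\<^esub> p = I +>\<^bsub>mpoly_ring n\<^esub> q \<longleftrightarrow> p - q \<in> I"
proof -
  interpret cring "mpoly_ring n :: 'k mpoly ring" by (rule cring_mpoly_ring)
  show ?thesis using quotient_eq_iff_same_a_r_cos[OF assms] minus_mpoly_ring[OF assms(2,3)] by simp
qed

lemma mult_by_coset:
  fixes I :: "'k::comm_ring_1 mpoly set"
  assumes "ideal I (mpoly_ring n)" "p \<in> carrier (mpoly_ring n)" "q \<in> carrier (mpoly_ring n)"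
  shows "mult_by n I p (I +>\<^bsub>mpoly_ring n\<^esub> q) = I +>\<^bsub>mpoly_ring n\<^esub> (p * q)"
  using ideal.rcoset_mult_add[OF assms] by (simp add: mult_by_def FactRing_def)

text \<open>If the variables are nilpotent, finitely many monomials span the quotient, and a
  descending chain of ideals becomes a chain of subspaces of a finite-dimensional space.\<close>

lemma artinian_quotient:
  fixes I :: "'k::field mpoly set"
  assumes I: "ideal I (mpoly_ring n)" and nil: "\<And>i. i \<le> n \<Longrightarrow> \<exists>e. mon (unit_exp i) 1 ^ e \<in> I"
  shows "artinian_ring (mpoly_ring n Quot I)"
proof -
  interpret R: cring "mpoly_ring n :: 'k mpoly ring" by (rule cring_mpoly_ring)
  interpret I: ideal I "mpoly_ring n :: 'k mpoly ring" by (rule I)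
  interpret cs: ring_hom_ring "mpoly_ring n" "mpoly_ring n Quot I" "(+>\<^bsub>mpoly_ring n\<^esub>) I"
    by (rule I.rcos_ring_hom_ring)
  let ?cs = "\<lambda>p. I +>\<^bsub>mpoly_ring n\<^esub> p"
  obtain e where e: "\<And>i. i \<le> n \<Longrightarrow> mon (unit_exp i) 1 ^ e i \<in> I" using nil by metis
  define Bm where "Bm = {m. Poly_Mapping.keys m \<subseteq> {..n} \<and> (\<forall>i\<le>n. Poly_Mapping.lookup m i < e i)}"
  have "Poly_Mapping.lookup ` Bm \<subseteq>
      {f. \<forall>i. (i \<in> {..n} \<longrightarrow> f i \<in> {..<Max (e ` {..n})}) \<and> (i \<notin> {..n} \<longrightarrow> f i = 0)}"
  proof (intro image_subsetI CollectI allI conjI impI)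
    fix m i assume m: "m \<in> Bm"
    show "Poly_Mapping.lookup m i \<in> {..<Max (e ` {..n})}" if "i \<in> {..n}"
    proof -
      have "e i \<le> Max (e ` {..n})" using that by (intro Max_ge) auto
      moreover have "Poly_Mapping.lookup m i < e i" using m that by (simp add: Bm_def)
      ultimately show ?thesis by simp
    qed
    show "Poly_Mapping.lookup m i = 0" if "i \<notin> {..n}"
      using m that unfolding Bm_def by (metis (mono_tags, lifting) mem_Collect_eq in_keys_iff subsetD)
  qed
  then have "finite (Poly_Mapping.lookup ` Bm)"
    by (rule finite_subset) (intro finite_set_of_finite_funs finite_atMost finite_lessThan)
  moreover have "inj_on Poly_Mapping.lookup Bm" by (intro inj_onI poly_mapping_eqI) simp
  ultimately have "finite Bm" by (rule finite_imageD)
  define B where "B = (\<lambda>m. mon m (1::'k)) ` Bm"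
  have finB: "finite B" using \<open>finite Bm\<close> by (simp add: B_def)
  have subB: "mpoly_space.span B \<subseteq> carrier (mpoly_ring n)"
    by (intro mpoly_space.span_minimal mpoly_space.subspaceI)
      (auto simp: B_def Bm_def intro!: carrier_mon carrier_closed)
  \<comment> \<open>A monomial outside \<open>Bm\<close> is divisible by a power of a variable that
    lies in \<open>I\<close>; dropping such terms keeps the residue class.\<close>
  have red: "\<exists>q'\<in>mpoly_space.span B. ?cs q = ?cs q'" if q: "q \<in> carrier (mpoly_ring n)" for q
  proof -
    let ?t = "\<lambda>m. mon m (Poly_Mapping.lookup q m)"
    let ?K = "Poly_Mapping.keys q"
    define q' where "q' = (\<Sum>m\<in>?K \<inter> Bm. ?t m)"
    have q': "q' \<in> mpoly_space.span B"
      unfolding q'_def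
    proof (rule mpoly_space.span_sum)
      fix m assume "m \<in> ?K \<inter> Bm"
      then have "mon 0 (Poly_Mapping.lookup q m) * mon m 1 \<in> mpoly_space.span B"
        by (intro mpoly_space.span_scale mpoly_space.span_base) (auto simp: B_def)
      then show "?t m \<in> mpoly_space.span B" by (simp add: mult_single)
    qed
    have "q - q' = (\<Sum>m\<in>?K - Bm. ?t m)"
      using sum.Int_Diff[of ?K ?t Bm] unfolding mpoly_eq_sum_mon[symmetric] q'_def
      by (metis add_diff_cancel_left' finite_keys)
    also have "\<dots> \<in> I"
    proof (rule ideal_sum[OF I])
      fix m assume m: "m \<in> ?K - Bm"
      then have k: "Poly_Mapping.keys m \<subseteq> {..n}" using q by (auto simp: mem_carrier_iff)
      then obtain i where i: "i \<le> n" "e i \<le> Poly_Mapping.lookup m i"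
        using m by (auto simp: Bm_def not_less)
      have "m = (m - Poly_Mapping.single i (e i)) + Poly_Mapping.single i (e i)"
        using i by (intro poly_mapping_eqI) (auto simp: lookup_add lookup_minus lookup_single when_def)
      then have "?t m = mon (m - Poly_Mapping.single i (e i)) (Poly_Mapping.lookup q m) * mon (unit_exp i) 1 ^ e i"
        unfolding var_power mult_single by simp
      moreover have "Poly_Mapping.keys (m - Poly_Mapping.single i (e i)) \<subseteq> {..n}"
      proof
        fix j assume "j \<in> Poly_Mapping.keys (m - Poly_Mapping.single i (e i))"
        then have "j \<in> Poly_Mapping.keys m" by (auto simp: in_keys_iff lookup_minus)
        then show "j \<in> {..n}" using k by blast
      qed
      ultimately show "?t m \<in> I"
        by (simp only: ideal_mpolyD(4)[OF I e[OF i(1)]] carrier_mon)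
    qed
    finally show ?thesis using q' q subB coset_eq_iff[OF I] by blast
  qed
  show ?thesis unfolding artinian_ring_def
  proof (intro conjI allI impI)
    show "ring (mpoly_ring n Quot I)" by (rule I.quotient_is_ring)
    fix J :: "nat \<Rightarrow> 'k mpoly set set"
    assume J: "(\<forall>m. ideal (J m) (mpoly_ring n Quot I)) \<and> (\<forall>m. J (Suc m) \<subseteq> J m)"
    \<comment> \<open>Representatives in \<open>span B\<close> turn ideals of the quotient into
      subspaces; by \<open>red\<close> each \<open>J m\<close> is recovered from
      \<open>U m\<close>.\<close>
    define U where "U m = {q \<in> mpoly_space.span B. ?cs q \<in> J m}" for m
    have sub: "mpoly_space.subspace (U m)" for m
    proof -
      interpret J: ideal "J m" "mpoly_ring n Quot I" using J by blast
      show ?thesis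
      proof (rule mpoly_space.subspaceI)
        show "0 \<in> U m"
          using additive_subgroup.zero_closed[OF J.additive_subgroup_axioms] cs.hom_zero
          by (simp add: U_def mpoly_space.span_zero)
        show "p + q \<in> U m" if pq: "p \<in> U m" "q \<in> U m" for p q
        proof -
          have "p \<in> carrier (mpoly_ring n)" "q \<in> carrier (mpoly_ring n)" "?cs p \<in> J m" "?cs q \<in> J m"
            using pq subB by (auto simp: U_def)
          then have "?cs (p + q) \<in> J m"
            using cs.hom_add additive_subgroup.a_closed[OF J.additive_subgroup_axioms] by simp
          then show ?thesis using pq by (auto simp: U_def intro: mpoly_space.span_add)
        qed
        show "mon 0 c * p \<in> U m" if p: "p \<in> U m" for c p
        proof -
          have c: "mon 0 c \<in> carrier (mpoly_ring n)" by (rule carrier_mon) simp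
          have "p \<in> carrier (mpoly_ring n)" "?cs p \<in> J m" using p subB by (auto simp: U_def)
          then have "?cs (mon 0 c * p) \<in> J m"
            using cs.hom_mult[OF c] J.I_l_closed[OF _ cs.hom_closed[OF c]] by simp
          then show ?thesis using p by (auto simp: U_def intro: mpoly_space.span_scale)
        qed
      qed
    qed
    have "U m \<subseteq> mpoly_space.span B" "U (Suc m) \<subseteq> U m" for m
      using J by (auto simp: U_def)
    then have "\<exists>M. \<forall>m\<ge>M. U m = U M"
      by (intro mpoly_space.decreasing_subspaces_stabilize[OF finB sub])
    then obtain M where M: "\<And>m. m \<ge> M \<Longrightarrow> U m = U M" by blast
    have "J m = J M" if "m \<ge> M" for m
    proof
      show "J m \<subseteq> J M" using lift_Suc_antimono_le[of J M m] J that by blast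
      show "J M \<subseteq> J m"
      proof
        fix X assume X: "X \<in> J M"
        interpret JM: ideal "J M" "mpoly_ring n Quot I" using J by blast
        obtain q where q: "q \<in> carrier (mpoly_ring n)" "X = ?cs q"
          using JM.a_subset X by (auto simp: FactRing_def A_RCOSETS_def')
        then obtain q' where "q' \<in> mpoly_space.span B" "X = ?cs q'" using red by metis
        then show "X \<in> J m" using M[OF that] X by (auto simp: U_def)
      qed
    qed
    then show "\<exists>m. \<forall>m'\<ge>m. J m' = J m" by blast
  qed
qed

lemma genideal_mpoly:
  fixes S :: "'k::comm_ring_1 mpoly set"
  assumes "S \<subseteq> carrier (mpoly_ring n)"
  shows "ideal (Idl\<^bsub>mpoly_ring n\<^esub> S) (mpoly_ring n)" "S \<subseteq> Idl\<^bsub>mpoly_ring n\<^esub> S"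
    "ideal J (mpoly_ring n) \<Longrightarrow> S \<subseteq> J \<Longrightarrow> Idl\<^bsub>mpoly_ring n\<^esub> S \<subseteq> J"
proof -
  interpret cring "mpoly_ring n :: 'k mpoly ring" by (rule cring_mpoly_ring)
  show "ideal (Idl\<^bsub>mpoly_ring n\<^esub> S) (mpoly_ring n)" "S \<subseteq> Idl\<^bsub>mpoly_ring n\<^esub> S"
    "ideal J (mpoly_ring n) \<Longrightarrow> S \<subseteq> J \<Longrightarrow> Idl\<^bsub>mpoly_ring n\<^esub> S \<subseteq> J"
    using genideal_ideal[OF assms] genideal_self[OF assms] genideal_minimal by blast+
qed

section \<open>Forms and criteria for the failure of injectivity and surjectivity\<close>

lemma forms_subset_carrier: "forms n d \<subseteq> carrier (mpoly_ring n)"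
  by (auto simp: forms_def)

lemma forms_mult: "p \<in> forms n d \<Longrightarrow> q \<in> forms n e \<Longrightarrow> p * q \<in> forms n (d + e)"
  using Poly_Mapping.keys_mult[of p q] by (fastforce simp: forms_def mdeg_add intro: carrier_closed)

lemma forms_power: "p \<in> forms n d \<Longrightarrow> p ^ k \<in> forms n (k * d)"
  by (induction k) (auto simp: forms_mult, simp add: forms_def mdeg_def)

lemma forms_sum: "(\<And>i. i \<in> A \<Longrightarrow> f i \<in> forms n d) \<Longrightarrow> sum f A \<in> forms n d"
  using keys_sum[of f A] by (fastforce simp: forms_def intro: carrier_sum)

lemma lin_form_in_forms: "lin_form n p \<in> forms n 1"
  unfolding lin_form_def by (rule forms_sum) (auto simp: forms_def mem_carrier_iff)

text \<open>The polynomials all of whose terms have degree above \<open>d\<close> form an ideal that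
  contains \<open>S\<close> but no nonzero form of degree \<open>d\<close>.\<close>

lemma form_notin_genideal:
  assumes "S \<subseteq> forms n (Suc d)" "F \<in> forms n d" "F \<noteq> 0"
  shows "F \<notin> Idl\<^bsub>mpoly_ring n\<^esub> S"
proof
  let ?J = "{q \<in> carrier (mpoly_ring n). \<forall>m\<in>Poly_Mapping.keys q. d < mdeg m}"
  assume "F \<in> Idl\<^bsub>mpoly_ring n\<^esub> S"
  moreover have "ideal ?J (mpoly_ring n)"
  proof (rule ideal_mpolyI)
    show "p + q \<in> ?J" if "p \<in> ?J" "q \<in> ?J" for p q
      using that Poly_Mapping.keys_add[of p q] by (auto intro: carrier_closed)
    show "q * p \<in> ?J" if "p \<in> ?J" "q \<in> carrier (mpoly_ring n)" for p q
      using that Poly_Mapping.keys_mult[of q p] by (fastforce simp: mdeg_add intro: carrier_closed)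
  qed auto
  moreover have "S \<subseteq> ?J" "S \<subseteq> carrier (mpoly_ring n)" using assms(1) by (auto simp: forms_def)
  ultimately have "F \<in> ?J" using genideal_mpoly(3) by blast
  then show False using assms(2,3) by (auto simp: forms_def)
qed

lemma not_injective_criterion:
  fixes I :: "'k::comm_ring_1 mpoly set"
  assumes I: "ideal I (mpoly_ring n)" and "L \<in> carrier (mpoly_ring n)" "F \<in> forms n i" "F \<notin> I" "L * F \<in> I"
  shows "\<not> inj_on (mult_by n I L) (quot_component n I i)"
proof
  let ?cs = "\<lambda>p. I +>\<^bsub>mpoly_ring n\<^esub> p"
  assume inj: "inj_on (mult_by n I L) (quot_component n I i)"
  have F: "F \<in> carrier (mpoly_ring n)" using assms(3) by (simp add: forms_def)
  have "0 \<in> forms n i" by (simp add: forms_def)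
  then have "?cs F \<in> quot_component n I i" "?cs 0 \<in> quot_component n I i"
    using assms(3) by (auto simp: quot_component_def)
  moreover have "mult_by n I L (?cs F) = mult_by n I L (?cs 0)"
    using assms(2,5) F by (simp add: mult_by_coset[OF I] coset_eq_iff[OF I] carrier_closed)
  ultimately have "?cs F = ?cs 0" using inj by (auto dest: inj_onD)
  then show False using assms(4) F by (simp add: coset_eq_iff[OF I])
qed

lemma not_surjective_criterion:
  fixes I :: "'k::comm_ring_1 mpoly set"
  assumes I: "ideal I (mpoly_ring n)" and L: "L \<in> carrier (mpoly_ring n)" and G: "G \<in> forms n (i + 1)"
    and "\<And>F. F \<in> carrier (mpoly_ring n) \<Longrightarrow> G - L * F \<notin> I"
  shows "mult_by n I L ` quot_component n I i \<noteq> quot_component n I (i + 1)"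
proof
  assume "mult_by n I L ` quot_component n I i = quot_component n I (i + 1)"
  then have "I +>\<^bsub>mpoly_ring n\<^esub> G \<in> mult_by n I L ` quot_component n I i"
    using G by (simp add: quot_component_def)
  then obtain F where F: "F \<in> forms n i" "I +>\<^bsub>mpoly_ring n\<^esub> G = mult_by n I L (I +>\<^bsub>mpoly_ring n\<^esub> F)"
    by (auto simp: quot_component_def)
  then have c: "F \<in> carrier (mpoly_ring n)" "G \<in> carrier (mpoly_ring n)" using G by (auto simp: forms_def)
  then have "G - L * F \<in> I"
    using F(2) L by (simp add: mult_by_coset[OF I] coset_eq_iff[OF I] carrier_closed)
  then show False using assms(4) c(1) by blast
qed

section \<open>Points of the scroll\<close>

lemma mon_word: "prod_list (map (\<lambda>i. mon (unit_exp i) (p i)) w) = mon (sum_list (map unit_exp w)) (prod_list (map p w))"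
  by (induction w) (simp_all add: mult_single)

lemma pairing_lin_form_power:
  "pairing \<psi> (lin_form n p ^ k) =
     (\<Sum>w | set w \<subseteq> {..n} \<and> length w = k. prod_list (map p w) * \<psi> (sum_list (map unit_exp w)))"
  unfolding lin_form_def power_sum_words[OF finite_atMost] mon_word pairing_sum pairing_single ..

lemma pairing_lin_form: "pairing \<psi> (lin_form n p) = (\<Sum>i\<le>n. p i * \<psi> (unit_exp i))"
  by (simp add: lin_form_def pairing_sum)

lemma unit_exp_eq_iff: "unit_exp i = unit_exp j \<longleftrightarrow> i = j"
  by (auto dest: arg_cong[of _ _ Poly_Mapping.keys])

lemma lookup_lin_form: "i \<le> n \<Longrightarrow> Poly_Mapping.lookup (lin_form n p) (unit_exp i) = p i"
  by (simp add: lin_form_def lookup_sum lookup_single when_def unit_exp_eq_iff)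

lemma lin_form_lin_coeff:
  assumes "L \<in> forms n 1" shows "lin_form n (lin_coeff L) = L"
proof (rule poly_mapping_eqI)
  fix m
  show "Poly_Mapping.lookup (lin_form n (lin_coeff L)) m = Poly_Mapping.lookup L m"
  proof (cases "\<exists>i\<le>n. m = unit_exp i")
    case True
    then show ?thesis by (auto simp: lookup_lin_form lin_coeff_def)
  next
    case False
    have "m \<notin> Poly_Mapping.keys q" if "q \<in> forms n 1" for q :: "'a mpoly"
    proof
      assume m: "m \<in> Poly_Mapping.keys q"
      then have "mdeg m = 1" "Poly_Mapping.keys m \<subseteq> {..n}"
        using that by (auto simp: forms_def mem_carrier_iff)
      moreover from this obtain i where "m = unit_exp i" using mdeg_eq_1_iff by blast
      ultimately show False using False by (simp add: unit_exp_eq_iff)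
    qed
    from this[OF assms] this[OF lin_form_in_forms[of n "lin_coeff L"]] show ?thesis
      by (simp add: in_keys_iff)
  qed
qed

lemma lin_form_diff: "lin_form n (\<lambda>i. p i - q i) = lin_form n p - lin_form n q"
  by (simp add: lin_form_def single_diff sum_subtractf)

definition scroll_point :: "'k \<Rightarrow> (nat \<Rightarrow> 'k) \<Rightarrow> nat \<Rightarrow> 'k::comm_ring_1" where
  "scroll_point u y i = u ^ tau i * y (grp i)"

lemma prod_list_scroll_point:
  "prod_list (map (scroll_point u y) w) =
     u ^ sum_list (map tau w) * (\<Prod>g\<in>#mset (map grp w). y g)"
  by (induction w) (simp_all add: scroll_point_def power_add algebra_simps)

definition curve_point :: "nat \<Rightarrow> 'k::comm_ring_1 \<Rightarrow> nat \<Rightarrow> 'k" where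
  "curve_point B t i = t ^ scroll_exp B i"

lemma curve_point_eq_scroll_point: "curve_point B t = scroll_point t (\<lambda>g. t ^ B ^ g)"
  by (rule ext) (simp add: curve_point_def scroll_point_def scroll_exp_def power_add)

lemma prod_list_curve_point: "prod_list (map (curve_point B t) w) = t ^ word_exp B w"
  by (induction w) (simp_all add: curve_point_def word_exp_def power_add)

lemma coeff_sum_monom: "coeff (\<Sum>w\<in>W. monom (f w) (c w)) d = (\<Sum>w | w \<in> W \<and> c w = d. f w)"
  if "finite W"
  using that by (simp add: coeff_sum sum.If_cases Int_def)

lemma degree_sum_monom_le:
  assumes "finite W" "\<And>w. w \<in> W \<Longrightarrow> c w \<le> D" shows "degree (\<Sum>w\<in>W. monom (f w) (c w)) \<le> D"
  by (intro degree_sum_le assms(1)) (meson assms(2) degree_monom_le order.trans)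

text \<open>The polynomial with these terms has at least as many zeros in \<open>T\<close> as it has
  exponents available, so it is 0; the sum in question is its coefficient at
  \<open>d\<close>.\<close>

lemma sparse_vanishing:
  fixes T :: "'k::field_char_0 set"
  assumes T: "finite T" "\<And>p. p \<noteq> 0 \<Longrightarrow> degree p \<le> D \<Longrightarrow> card {t \<in> T. poly p t = 0} < card {i. coeff p i \<noteq> 0}"
    and W: "finite W" "\<And>w. w \<in> W \<Longrightarrow> c w \<le> D"
    and Z: "Z \<subseteq> T" "card (c ` W) \<le> card Z" "\<And>t. t \<in> Z \<Longrightarrow> (\<Sum>w\<in>W. f w * t ^ c w) = 0"
  shows "(\<Sum>w | w \<in> W \<and> c w = d. f w) = 0"
proof -
  let ?p = "\<Sum>w\<in>W. monom (f w) (c w)"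
  have "?p = 0"
  proof (rule ccontr)
    assume "?p \<noteq> 0"
    then have "card {t \<in> T. poly ?p t = 0} < card {i. coeff ?p i \<noteq> 0}"
      using T(2) degree_sum_monom_le[of W c D f] W by blast
    also have "\<dots> \<le> card (c ` W)"
    proof (rule card_mono)
      show "{i. coeff ?p i \<noteq> 0} \<subseteq> c ` W"
      proof
        fix i assume "i \<in> {i. coeff ?p i \<noteq> 0}"
        then have "{w \<in> W. c w = i} \<noteq> {}" unfolding coeff_sum_monom[OF W(1)] by (metis (mono_tags, lifting) mem_Collect_eq sum.empty)
        then show "i \<in> c ` W" by blast
      qed
    qed (use W in simp)
    also have "\<dots> \<le> card Z" by (rule Z(2))
    also have "\<dots> \<le> card {t \<in> T. poly ?p t = 0}"
      using Z(1,3) T(1) by (intro card_mono) (auto simp: poly_sum poly_monom)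
    finally show False by simp
  qed
  then show ?thesis using coeff_sum_monom[OF W(1), of f c d] by simp
qed

text \<open>On the curve a linear equation becomes a polynomial in \<open>t\<close> whose
  \<open>n + 1\<close> possible exponents are distinct, so \<open>n + 1\<close> zeros in
  \<open>T\<close> force every coefficient to vanish.\<close>

lemma curve_points_general_position:
  fixes T :: "'k::field_char_0 set"
  assumes n: "n \<ge> 4" "B > 2"
    and T: "finite T" "\<And>p. p \<noteq> 0 \<Longrightarrow> degree p \<le> D \<Longrightarrow> card {t \<in> T. poly p t = 0} < card {i. coeff p i \<noteq> 0}"
    and D: "\<And>i. i \<le> n \<Longrightarrow> scroll_exp B i \<le> D"
    and Z: "Z \<subseteq> T" "card Z = n + 1" "\<And>t. t \<in> Z \<Longrightarrow> (\<Sum>i\<le>n. curve_point B t i * v i) = 0"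
    and i: "i \<le> n"
  shows "v i = 0"
proof -
  have inj: "inj_on (scroll_exp B) {..n}" by (rule scroll_exp_inj[OF n])
  have "(\<Sum>w | w \<in> {..n} \<and> scroll_exp B w = scroll_exp B i. v w) = 0"
    using D Z card_image[OF inj]
    by (intro sparse_vanishing[OF T, where Z = Z]) (auto simp: curve_point_def mult.commute)
  moreover have "{w. w \<in> {..n} \<and> scroll_exp B w = scroll_exp B i} = {i}"
    using i inj by (auto dest: inj_onD)
  ultimately show ?thesis by simp
qed

text \<open>By duality it suffices that a functional killing the powers at the points of
  \<open>T\<close>, in effect a form of degree \<open>k\<close> vanishing there, kills the powers at
  all scroll points. On the curve this form has at most \<open>card T\<close> exponents, so it
  vanishes identically.\<close>

lemma scroll_power_in_span:
  fixes T :: "'k::field_char_0 set"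
  assumes n: "n \<ge> 4" "B > 2 * k"
    and T: "finite T" "\<And>p. p \<noteq> 0 \<Longrightarrow> degree p \<le> D \<Longrightarrow> card {t \<in> T. poly p t = 0} < card {i. coeff p i \<noteq> 0}"
    and D: "\<And>w. set w \<subseteq> {..n} \<Longrightarrow> length w = k \<Longrightarrow> word_exp B w \<le> D"
    and card: "card (word_exp B ` {w. set w \<subseteq> {..n} \<and> length w = k}) \<le> card T"
  shows "lin_form n (scroll_point u y) ^ k \<in> mpoly_space.span ((\<lambda>t. lin_form n (curve_point B t) ^ k) ` T)"
proof (rule ccontr)
  let ?W = "{w. set w \<subseteq> {..n} \<and> length w = k}"
  assume "\<not> ?thesis"
  then obtain \<psi> where \<psi>: "\<And>t. t \<in> T \<Longrightarrow> pairing \<psi> (lin_form n (curve_point B t) ^ k) = 0"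
      "pairing \<psi> (lin_form n (scroll_point u y) ^ k) = 1"
    using separating_functional by blast
  let ?f = "\<lambda>w. \<psi> (sum_list (map unit_exp w))"
  let ?z = "\<lambda>w. prod_list (map (scroll_point u y) w)"
  have fin: "finite ?W" by (rule finite_words) simp
  have vanish: "(\<Sum>w | w \<in> ?W \<and> word_exp B w = d. ?f w) = 0" for d
  proof (rule sparse_vanishing[OF T fin _ order.refl card])
    show "(\<Sum>w\<in>?W. ?f w * t ^ word_exp B w) = 0" if "t \<in> T" for t
      using \<psi>(1)[OF that] unfolding pairing_lin_form_power prod_list_curve_point by (simp add: mult.commute)
  qed (use D in auto)
  \<comment> \<open>Words with the same exponent have the same value at every scroll point, so the
    sum is that value times a coefficient already known to be 0.\<close>
  have "(\<Sum>w\<in>{w \<in> ?W. word_exp B w = d}. ?z w * ?f w) = 0" for d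
  proof (cases "{w \<in> ?W. word_exp B w = d} = {}")
    case False
    then obtain w0 where w0: "w0 \<in> ?W" "word_exp B w0 = d" by blast
    have "?z w = ?z w0" if "w \<in> {w \<in> ?W. word_exp B w = d}" for w
      using word_exp_decode[OF n(1), of w w0 B] that w0 n(2) by (simp add: prod_list_scroll_point)
    then have "(\<Sum>w\<in>{w \<in> ?W. word_exp B w = d}. ?z w * ?f w) = ?z w0 * (\<Sum>w\<in>{w \<in> ?W. word_exp B w = d}. ?f w)"
      by (simp add: sum_distrib_left)
    then show ?thesis using vanish[of d] by simp
  next
    case True
    show ?thesis unfolding True by simp
  qed
  then have "pairing \<psi> (lin_form n (scroll_point u y) ^ k) = 0"
    unfolding pairing_lin_form_power by (subst sum.image_gen[OF fin, of _ "word_exp B"]) simp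
  then show False using \<psi>(2) by simp
qed

section \<open>Secants of the scroll and the cubic cone through it\<close>

lemma secant_decomposition:
  fixes P :: "nat \<Rightarrow> 'k::field"
  assumes "P 3 \<noteq> 0" "P 4 \<noteq> 0"
  obtains u y y' where "P = (\<lambda>i. scroll_point u y i - scroll_point 0 y' i)"
proof
  \<comment> \<open>A scroll point with parameter 0 has zero coordinates 1, 3 and 4. These
    coordinates of \<open>P\<close> thus come from the first point alone, which forces
    \<open>u = P 4 / P 3\<close>; the second point corrects the coordinates 0 and 2.\<close>
  let ?u = "P 4 / P 3"
  let ?y = "\<lambda>g. if g = 1 then P 1 / ?u else if g = 2 then P 3 / ?u else P (g + 2)"
  let ?y' = "\<lambda>g. if g = 1 then P 1 / ?u - P 0 else if g = 2 then P 3 / ?u - P 2 else 0"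
  show "P = (\<lambda>i. scroll_point ?u ?y i - scroll_point 0 ?y' i)"
  proof
    fix i :: nat
    consider "i = 0" | "i = 1" | "i = 2" | "i = 3" | "i = 4" | "i \<ge> 5" by linarith
    then show "P i = scroll_point ?u ?y i - scroll_point 0 ?y' i"
    proof cases
      case 6
      then have "Suc (Suc (i - 2)) = i" by arith
      with 6 show ?thesis by (simp add: scroll_point_def tau_def grp_def)
    qed (use assms in \<open>auto simp: scroll_point_def tau_def grp_def field_simps power2_eq_square\<close>)
  qed
qed

definition vec5 :: "'k \<Rightarrow> 'k \<Rightarrow> 'k \<Rightarrow> 'k \<Rightarrow> 'k \<Rightarrow> nat \<Rightarrow> 'k::comm_ring_1" where
  "vec5 a b c d e i = (if i = 0 then a else if i = 1 then b else if i = 2 then c else if i = 3 then d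
     else if i = 4 then e else 0)"

lemma dot_vec5:
  assumes "n \<ge> 4"
  shows "dot n p (vec5 a b c d e) = p 0 * a + p 1 * b + p 2 * c + p 3 * d + p 4 * e"
proof -
  have "dot n p (vec5 a b c d e) = (\<Sum>i\<in>{0, 1, 2, 3, 4}. p i * vec5 a b c d e i)"
    unfolding dot_def using assms by (intro sum.mono_neutral_right) (auto simp: vec5_def)
  then show ?thesis by (simp add: vec5_def)
qed

lemma cone_functional:
  fixes P :: "nat \<Rightarrow> 'k::field_char_0"
  assumes n: "n \<ge> 4" and k: "k \<ge> 3"
    and gen: "P 0 \<noteq> 0" "P 0 * P 3 \<noteq> P 1 * P 2" "P 1 * P 1 * P 2 \<noteq> P 0 * P 0 * P 4"
  obtains \<phi> where "\<And>p q. \<phi> (p + q) = \<phi> p + (\<phi> q :: 'k)" "\<And>F. \<phi> (lin_form n P * F) = 0"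
    "\<And>u y r. \<phi> (r * lin_form n (scroll_point u y) ^ k) = 0"
    "\<phi> (lin_form n (vec5 0 0 0 1 0) ^ k) \<noteq> 0"
proof
  \<comment> \<open>Write \<open>Z z\<close> for the matrix with rows \<open>(z 0, z 2, z 3)\<close> and \<open>(z 1, z 3, z 4)\<close>, which has rank at most 1
    on the scroll. The vector \<open>c\<close> spans the kernel of \<open>Z P\<close> and \<open>b = Z z c\<close>. On the scroll \<open>b2 = u * b1\<close>,
    so the quadrics \<open>b1 * z 1 - b2 * z 0\<close> and \<open>b1 * z 3 - b2 * z 2\<close> vanish there; the combination of them
    with coefficients \<open>b1 * P 3 - b2 * P 2\<close> and \<open>- (b1 * P 1 - b2 * P 0)\<close> is the cubic cone
    \<open>b1^2 * al + b1 * b2 * be + b2^2 * ga\<close>, all of whose linear factors vanish at \<open>P\<close>.\<close>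
  define c0 c1 c2 where "c0 = P 2 * P 4 - P 3 * P 3" and "c1 = P 3 * P 1 - P 0 * P 4"
    and "c2 = P 0 * P 3 - P 1 * P 2"
  note c = c0_def c1_def c2_def
  define b1 b2 where "b1 = vec5 c0 0 c1 c2 0" and "b2 = vec5 0 c0 0 c1 c2"
  define al be ga where "al = vec5 0 (P 3) 0 (- P 1) 0" and "be = vec5 (- P 3) (- P 2) (P 1) (P 0) 0"
    and "ga = vec5 (P 2) 0 (- P 0) 0 0"
  \<comment> \<open>The form \<open>P 0 * z 3 - P 3 * z 0\<close> vanishes at \<open>P\<close>; its
    powers raise the cubic cone to degree \<open>k\<close> while keeping the vertex.\<close>
  define rest where "rest = replicate (k - 3) (vec5 (- P 3) 0 0 (P 0) 0)"
  define \<phi> where "\<phi> q = pairing (product_functional n ([b1, b1, al] @ rest)) q +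
     pairing (product_functional n ([b1, b2, be] @ rest)) q + pairing (product_functional n ([b2, b2, ga] @ rest)) q" for q
  note vs = b1_def b2_def al_def be_def ga_def
  define C where "C p = dot n p b1 * dot n p b1 * dot n p al + dot n p b1 * dot n p b2 * dot n p be
     + dot n p b2 * dot n p b2 * dot n p ga" for p
  have power: "\<phi> (lin_form n p ^ k * q) =
     fact k * C p * prod_list (map (dot n p) rest) * Poly_Mapping.lookup q 0" for p q
    using k unfolding \<phi>_def
    by (subst (1 2 3) pairing_product_functional_power) (auto simp: rest_def C_def algebra_simps)
  show "\<phi> (p + q) = \<phi> p + \<phi> q" for p q by (simp add: \<phi>_def pairing_add)
  show "\<phi> (lin_form n P * F) = 0" for F
    unfolding \<phi>_def using n
    by (subst (1 2 3) pairing_product_functional_lin_form)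
      (auto simp: rest_def vs dot_vec5 c algebra_simps)
  show "\<phi> (r * lin_form n (scroll_point u y) ^ k) = 0" for u y r
  proof -
    have "C (scroll_point u y) = 0"
      unfolding C_def vs dot_vec5[OF n]
      by (simp add: scroll_point_def tau_def grp_def algebra_simps power2_eq_square)
    then show ?thesis using power[of "scroll_point u y" r] by (simp add: mult.commute)
  qed
  \<comment> \<open>The coordinate point with index 3 is off the cone: the cubic takes there the
    product of two differences assumed to be nonzero, and the padding form takes the value
    \<open>P 0\<close>.\<close>
  let ?e = "vec5 0 0 0 1 (0::'k)"
  have "C ?e = c2 * (c1 * P 0 - c2 * P 1)"
    unfolding C_def vs dot_vec5[OF n] by (simp add: vec5_def algebra_simps)
  also have "c1 * P 0 - c2 * P 1 = P 1 * P 1 * P 2 - P 0 * P 0 * P 4" by (simp add: c algebra_simps)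
  finally have "C ?e \<noteq> 0" using gen by (simp add: c2_def)
  moreover have "prod_list (map (dot n ?e) rest) = P 0 ^ (k - 3)"
    by (simp add: rest_def dot_vec5[OF n] prod_list_replicate) (simp add: vec5_def)
  ultimately show "\<phi> (lin_form n ?e ^ k) \<noteq> 0" using power[of ?e 1] gen(1) by simp
qed

theorem corollary2p20:
  fixes n k N :: nat
  assumes "n \<ge> 4" and "k \<ge> 3" and "int N \<ge> f_bound n k"
  shows "\<exists>L :: nat \<Rightarrow> ('k :: {alg_closed_field, field_char_0}) mpoly.
           (\<forall>j\<in>{1..N}. L j \<in> forms n 1) \<and>
           (\<forall>J \<subseteq> {1..N}. card J = n + 1 \<longrightarrow> \<not> common_zero_proj n (L ` J)) \<and>
           fails_WLP_from n (Idl\<^bsub>mpoly_ring n\<^esub> ((\<lambda>j. L j ^ k) ` {1..N})) (k - 1)"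
proof -
  note n = \<open>n \<ge> 4\<close> and k = \<open>k \<ge> 3\<close>
  \<comment> \<open>Every digit of the exponent of a word of length \<open>k\<close> is at most
    \<open>2 * k\<close>, so this base rules out carries.\<close>
  define B where "B = 2 * k + 1"
  have B: "B > 2 * k" "B > 2" using k by (auto simp: B_def)
  let ?W = "{w. set w \<subseteq> {..n} \<and> length w = k}"
  have finW: "finite ?W" by (rule finite_words) simp
  \<comment> \<open>The degree bound must serve both uses of the points: words of length
    \<open>k\<close> for vanishing on the scroll, and single coordinates for linear
    independence.\<close>
  define D where "D = Max (word_exp B ` ?W \<union> scroll_exp B ` {..n})"
  have D: "word_exp B w \<le> D" if "set w \<subseteq> {..n}" "length w = k" for w
    unfolding D_def using finW that by (intro Max_ge) auto
  have D': "scroll_exp B i \<le> D" if "i \<le> n" for i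
    unfolding D_def using finW that by (intro Max_ge) auto
  have hilb: "((n + k - 2) choose (n - 2)) + 2 * ((n + k - 3) choose (n - 2)) \<le> N"
    using scroll_hilbert_le_f_bound[OF n k] assms(3) by linarith
  \<comment> \<open>From \<open>k \<ge> 3\<close> this gives at least \<open>n + 1\<close> forms,
    enough to span all linear forms below.\<close>
  have "n + k - 2 \<le> (n + k - 2) choose (n - 2)" using n k by (intro le_binomial) auto
  then have N: "n + 1 \<le> N" using hilb k by linarith
  obtain T :: "'k set" where T: "finite T" "card T = N"
      "\<And>p. p \<noteq> 0 \<Longrightarrow> degree p \<le> D \<Longrightarrow> card {t \<in> T. poly p t = 0} < card {i. coeff p i \<noteq> 0}"
    using sparse_general_points[of N D] by blast
  note T' = T(1,3)
  obtain t where t: "bij_betw t {1..N} T" using ex_bij_betw_nat_finite_1[OF T(1)] T(2) by blast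
  define L where "L j = lin_form n (curve_point B (t j))" for j
  have L_form: "L j \<in> forms n 1" for j unfolding L_def by (rule lin_form_in_forms)
  have general: "\<forall>i\<le>n. v i = 0"
    if "J \<subseteq> {1..N}" "card J = n + 1" "\<And>j. j \<in> J \<Longrightarrow> (\<Sum>i\<le>n. curve_point B (t j) i * v i) = 0" for J v
  proof -
    have "inj_on t J" using bij_betw_imp_inj_on[OF t] that(1) inj_on_subset by blast
    then have "card (t ` J) = n + 1" using that(2) by (simp add: card_image)
    moreover have "t ` J \<subseteq> T" using bij_betw_imp_surj_on[OF t] that(1) by blast
    ultimately show ?thesis
      using curve_points_general_position[OF n B(2) T' D', of "t ` J" v] that(3) by blast
  qed
  have lgp: "\<not> common_zero_proj n (L ` J)" if "J \<subseteq> {1..N}" "card J = n + 1" for J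
    using general[OF that] by (fastforce simp: common_zero_proj_def L_def eval_lin_form)
  define S where "S = (\<lambda>j. L j ^ k) ` {1..N}"
  define I where "I = Idl\<^bsub>mpoly_ring n\<^esub> S"
  have S_forms: "S \<subseteq> forms n k" using forms_power[OF L_form, where k = k] by (auto simp: S_def)
  then have S_carrier: "S \<subseteq> carrier (mpoly_ring n)" using forms_subset_carrier by blast
  have I: "ideal I (mpoly_ring n)" and S_I: "S \<subseteq> I"
    unfolding I_def using genideal_mpoly(1,2)[OF S_carrier] by auto
  have S_eq: "S = (\<lambda>t. lin_form n (curve_point B t) ^ k) ` T"
    unfolding S_def L_def using bij_betw_imp_surj_on[OF t] by (metis (no_types, lifting) image_cong image_image)
  have scroll: "lin_form n (scroll_point u y) ^ k \<in> I" for u y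
    using scroll_power_in_span[OF n B(1) T' D] card_word_exps_le[OF n, of k B] k hilb T(2)
      span_subset_ideal[OF I S_I] unfolding S_eq by fastforce
  have artinian: "artinian_ring (mpoly_ring n Quot I)"
  proof (rule artinian_quotient[OF I])
    fix i assume i: "i \<le> n"
    \<comment> \<open>Any \<open>n + 1\<close> of the chosen forms span the linear forms, and each
      has its \<open>k\<close>-th power in \<open>I\<close>; hence every variable is nilpotent
      modulo \<open>I\<close>.\<close>
    have "mon (unit_exp i) 1 \<in> mpoly_space.span (L ` {1..n + 1})"
    proof (rule ccontr)
      assume "\<not> ?thesis"
      then obtain \<psi> where \<psi>: "\<And>j. j \<in> {1..n + 1} \<Longrightarrow> pairing \<psi> (L j) = 0" "pairing \<psi> (mon (unit_exp i) 1) = 1"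
        using separating_functional by blast
      then have "\<forall>i\<le>n. \<psi> (unit_exp i) = 0"
        using N by (intro general[of "{1..n + 1}"]) (auto simp: L_def pairing_lin_form)
      then show False using \<psi>(2) i by simp
    qed
    moreover have "\<exists>e. s ^ e \<in> I" if "s \<in> L ` {1..n + 1}" for s
      using that S_I N by (force simp: S_def)
    moreover have "L ` {1..n + 1} \<subseteq> carrier (mpoly_ring n)"
      using L_form forms_subset_carrier by blast
    ultimately show "\<exists>e. mon (unit_exp i) 1 ^ e \<in> I" using nilpotent_span[OF I] by blast
  qed
  let ?X = "\<lambda>i. mon (unit_exp i) (1 :: 'k)"
  \<comment> \<open>Nonvanishing of coordinates 3 and 4 yields the secant through \<open>M\<close>;
    coordinate 0 and the last two factors are what the cubic cone requires.\<close>
  let ?Pol = "?X 0 * ?X 3 * ?X 4 * (?X 0 * ?X 3 - ?X 1 * ?X 2) * (?X 1 * ?X 1 * ?X 2 - ?X 0 * ?X 0 * ?X 4)"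
  have eval_Pol: "eval_mpoly P ?Pol =
      P 0 * P 3 * P 4 * (P 0 * P 3 - P 1 * P 2) * (P 1 * P 1 * P 2 - P 0 * P 0 * P 4)" for P
    by (simp only: eval_mpoly_mult eval_mpoly_diff eval_mpoly_unit_exp mult_1)
  define U where "U = {M \<in> forms n 1. \<exists>P\<in>{?Pol}. eval_mpoly (lin_coeff M) P \<noteq> 0}"
  have "?Pol \<in> carrier (mpoly_ring n)"
    using n by (intro carrier_closed carrier_mon) auto
  then have U_open: "zariski_open_linear n U"
    unfolding zariski_open_linear_def U_def by (intro exI[of _ "{?Pol}"]) auto
  \<comment> \<open>At this point \<open>?Pol\<close> takes the value -1.\<close>
  have "lin_form n (vec5 1 0 0 1 1) \<in> U"
    unfolding U_def eval_Pol bex_simps mem_Collect_eq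
    using n lin_form_in_forms[of n "vec5 1 0 0 1 (1 :: 'k)"]
    by (simp add: eval_Pol lin_coeff_def lookup_lin_form vec5_def del: eval_mpoly_mult)
  then have U_ne: "U \<noteq> {}" by blast
  have fail: "\<not> inj_on (mult_by n I M) (quot_component n I (k - 1)) \<and>
      mult_by n I M ` quot_component n I (k - 1) \<noteq> quot_component n I (k - 1 + 1)" if "M \<in> U" for M
  proof
    define P where "P = lin_coeff M"
    have M_form: "M \<in> forms n 1" using that unfolding U_def by blast
    have M: "M = lin_form n P" "M \<in> carrier (mpoly_ring n)"
      using lin_form_lin_coeff[OF M_form] subsetD[OF forms_subset_carrier M_form] unfolding P_def by simp_all
    have "eval_mpoly P ?Pol \<noteq> 0" using that unfolding U_def P_def by blast
    then have gen: "P 0 \<noteq> 0" "P 3 \<noteq> 0" "P 4 \<noteq> 0" "P 0 * P 3 \<noteq> P 1 * P 2" "P 1 * P 1 * P 2 \<noteq> P 0 * P 0 * P 4"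
      unfolding eval_Pol by auto
    show "\<not> inj_on (mult_by n I M) (quot_component n I (k - 1))"
    proof -
      obtain u y y' where P: "P = (\<lambda>i. scroll_point u y i - scroll_point 0 y' i)"
        using secant_decomposition[OF gen(2,3)] .
      define p q where "p = lin_form n (scroll_point u y)" and "q = lin_form n (scroll_point 0 y')"
      \<comment> \<open>\<open>F\<close> is the cofactor of \<open>p - q\<close> in
        \<open>p ^ k - q ^ k\<close>, and \<open>M = p - q\<close>.\<close>
      define F where "F = (\<Sum>i<k. q ^ (k - Suc i) * p ^ i)"
      have MF: "M * F = p ^ k - q ^ k"
        unfolding F_def M(1) P lin_form_diff p_def q_def by (rule power_diff_sumr2[symmetric])
      have "q ^ (k - Suc i) * p ^ i \<in> forms n (k - 1)" if "i < k" for i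
        using forms_mult[OF forms_power[OF lin_form_in_forms, where k = "k - Suc i"]
            forms_power[OF lin_form_in_forms, where k = i]] that
        by (simp add: p_def q_def)
      then have F: "F \<in> forms n (k - 1)" unfolding F_def by (intro forms_sum) auto
      \<comment> \<open>At the coordinate point with index 4 the form \<open>q\<close> vanishes and
        \<open>p\<close> takes the value \<open>P 4\<close>, so \<open>M * F\<close> is nonzero
        there.\<close>
      have "eval_mpoly (vec5 0 0 0 0 1) (lin_form n v) = v 4" for v :: "nat \<Rightarrow> 'k"
        using dot_vec5[OF n, of v 0 0 0 0 1] by (simp add: eval_lin_form dot_def)
      then have "eval_mpoly (vec5 0 0 0 0 1) (M * F) = P 4 ^ k"
        using k unfolding MF p_def q_def P
        by (simp add: eval_mpoly_diff eval_mpoly_power) (simp add: scroll_point_def tau_def)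
      then have "F \<noteq> 0" using gen(3) by (auto simp: eval_mpoly_pairing)
      then have "F \<notin> I" unfolding I_def
        using form_notin_genideal[of S n "k - 1" F] S_forms F k by simp
      moreover have "M * F \<in> I" unfolding MF p_def q_def by (intro ideal_mpolyD(5)[OF I] scroll)
      ultimately show ?thesis by (intro not_injective_criterion[OF I M(2) F])
    qed
    show "mult_by n I M ` quot_component n I (k - 1) \<noteq> quot_component n I (k - 1 + 1)"
    proof (rule not_surjective_criterion[OF I M(2)])
      let ?G = "lin_form n (vec5 0 0 0 1 (0 :: 'k)) ^ k"
      show "?G \<in> forms n (k - 1 + 1)" using forms_power[OF lin_form_in_forms, where k = k] k by simp
      obtain \<phi> where \<phi>: "\<And>p q. \<phi> (p + q) = \<phi> p + (\<phi> q :: 'k)" "\<And>F. \<phi> (lin_form n P * F) = 0"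
          "\<And>u y r. \<phi> (r * lin_form n (scroll_point u y) ^ k) = 0" "\<phi> ?G \<noteq> 0"
        using cone_functional[OF n k gen(1,4,5)] by blast
      \<comment> \<open>The kernel of \<open>\<phi>\<close> need not be an ideal; asking that
        \<open>\<phi>\<close> kill all multiples gives one, and then only the generators of
        \<open>I\<close> have to be checked.\<close>
      let ?A = "{q \<in> carrier (mpoly_ring n). \<forall>r. \<phi> (r * q) = 0}"
      have "ideal ?A (mpoly_ring n)"
      proof (rule ideal_mpolyI)
        have "\<phi> 0 = 0" using \<phi>(1)[of 0 0] by simp
        then show "0 \<in> ?A" by simp
        show "p + q \<in> ?A" if "p \<in> ?A" "q \<in> ?A" for p q
          using that by (auto simp: ring_distribs \<phi>(1) intro: carrier_closed)
        show "q * p \<in> ?A" if "p \<in> ?A" "q \<in> carrier (mpoly_ring n)" for p q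
          using that by (auto simp flip: mult.assoc intro: carrier_closed)
      qed auto
      moreover have "S \<subseteq> ?A" using S_carrier \<phi>(3) by (auto simp: S_eq curve_point_eq_scroll_point)
      ultimately have "I \<subseteq> ?A" unfolding I_def by (rule genideal_mpoly(3)[OF S_carrier])
      then have zero: "\<phi> q = 0" if "q \<in> I" for q using that by (metis (mono_tags, lifting) mem_Collect_eq mult_1 subsetD)
      show "?G - M * F \<notin> I" if "F \<in> carrier (mpoly_ring n)" for F
        using zero[of "?G - M * F"] \<phi>(1)[of "?G - M * F" "M * F"] \<phi>(2)[of F] \<phi>(4) by (auto simp: M(1))
    qed
  qed
  have "fails_WLP_from n I (k - 1)"
    unfolding fails_WLP_from_def holds_for_general_linear_form_def
    using artinian U_open U_ne fail by blast
  then show ?thesis using L_form lgp unfolding I_def S_def by blast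
qed

end
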